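(* Let $X_1,\dots,X_n$ be Polish spaces, $1\le k<n$, let $\{\mu_\alpha\}_{\alpha\in\mathcal{I}_{nk}}$, $\mu_\alpha\in\mathcal{P}(X_\alpha)$, be a reducible family, and let $c:X\to[-\infty,+\infty]$ be Borel measurable. Suppose there exist integrable functions $c_\alpha:X_\alpha\to(-\infty,+\infty]$, $c_\alpha\in L^1(\mu_\alpha)$, with $|c(x)|\le\sum_{\alpha\in\mathcal{I}_{nk}}c_\alpha(x_\alpha)$ for all $x\in X$. Then $$J=\sup\Big\{\sum_{\alpha\in\mathcal{I}_{nk}}\int_{X_\alpha}f_\alpha\,d\mu_\alpha:\ \{f_\alpha\}\in\Psi_c(\mu_\alpha)\Big\}$$ is finite and attained by some $\{f_\alpha\}\in\Psi_c(\mu_\alpha)$.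
   Context: $X=\prod_iX_i$; $\mathcal{I}_{nk}$ is the family of $k$-element subsets of $\{1,\dots,n\}$; $X_\alpha=\prod_{i\in\alpha}X_i$, $\mathrm{Pr}_\alpha$ the projection, $x_\alpha=\mathrm{Pr}_\alpha(x)$. Two measures are uniformly equivalent if one has a density with respect to the other bounded above and below by positive constants. The family $\{\mu_\alpha\}$ is reducible if there is a probability measure $\mu$ on $X$ with $\mathrm{Pr}_\alpha(\mu)=\mu_\alpha$ for all $\alpha\in\mathcal{I}_{nk}$ that is uniformly equivalent to $\prod_i\nu_i$ for some $\nu_i\in\mathcal{P}(X_i)$. A measurable set $A\subseteq X$ has zero $(n,k)$-thickness if there are measurable $Y_\alpha\subseteq X_\alpha$ with $\mu_\alpha(Y_\alpha)=0$ and $A\subseteq\bigcup_\alpha\mathrm{Pr}_\alpha^{-1}(Y_\alpha)$. $\Psi_c(\mu_\alpha)$ is the set of tuples $\{f_\alpha\}_{\alpha\in\mathcal{I}_{nk}}$ of real-valued functions $f_\alpha\in L^1(X_\alpha,\mu_\alpha)$ such that $\sum_\alpha f_\alpha(x_\alpha)\le c(x)$ for all $x\in X$ outside a set of zero $(n,k)$-thickness (relaxed dual problem). *)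

theory Defs
  imports "HOL-Probability.Probability"
begin

definition Polish_space :: "'a topology \<Rightarrow> bool" where
  "Polish_space T \<longleftrightarrow> completely_metrizable_space T \<and> separable_space T"

definition borel_of :: "'a topology \<Rightarrow> 'a measure" where
  "borel_of T = sigma (topspace T) {U. openin T U}"

definition Ink :: "nat \<Rightarrow> nat \<Rightarrow> nat set set" where
  "Ink n k = {\<alpha>. \<alpha> \<subseteq> {1..n} \<and> card \<alpha> = k}"

definition Xa :: "(nat \<Rightarrow> 'a topology) \<Rightarrow> nat set \<Rightarrow> (nat \<Rightarrow> 'a) measure" where
  "Xa X \<alpha> = PiM \<alpha> (\<lambda>i. borel_of (X i))"

definition Pr :: "nat set \<Rightarrow> (nat \<Rightarrow> 'a) \<Rightarrow> (nat \<Rightarrow> 'a)" where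
  "Pr \<alpha> x = restrict x \<alpha>"

definition unif_equiv :: "'b measure \<Rightarrow> 'b measure \<Rightarrow> bool" where
  "unif_equiv \<mu> \<nu> \<longleftrightarrow> (\<exists>g a b. g \<in> borel_measurable \<nu> \<and> 0 < a \<and> a \<le> b \<and>
      (\<forall>x\<in>space \<nu>. a \<le> g x \<and> g x \<le> b) \<and> \<mu> = density \<nu> (\<lambda>x. ennreal (g x)))"

definition reducible :: "(nat \<Rightarrow> 'a topology) \<Rightarrow> nat \<Rightarrow> nat \<Rightarrow>
    (nat set \<Rightarrow> (nat \<Rightarrow> 'a) measure) \<Rightarrow> bool" where
  "reducible X n k \<mu>a \<longleftrightarrow> (\<exists>\<mu> \<nu>.
      prob_space \<mu> \<and> sets \<mu> = sets (Xa X {1..n}) \<and>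
      (\<forall>\<alpha>\<in>Ink n k. distr \<mu> (Xa X \<alpha>) (Pr \<alpha>) = \<mu>a \<alpha>) \<and>
      (\<forall>i\<in>{1..n}. prob_space (\<nu> i) \<and> sets (\<nu> i) = sets (borel_of (X i))) \<and>
      unif_equiv \<mu> (PiM {1..n} \<nu>))"

definition zero_thickness :: "(nat \<Rightarrow> 'a topology) \<Rightarrow> nat \<Rightarrow> nat \<Rightarrow>
    (nat set \<Rightarrow> (nat \<Rightarrow> 'a) measure) \<Rightarrow> (nat \<Rightarrow> 'a) set \<Rightarrow> bool" where
  "zero_thickness X n k \<mu>a A \<longleftrightarrow> A \<in> sets (Xa X {1..n}) \<and>
     (\<exists>Y. (\<forall>\<alpha>\<in>Ink n k. Y \<alpha> \<in> sets (Xa X \<alpha>) \<and> measure (\<mu>a \<alpha>) (Y \<alpha>) = 0) \<and>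
          A \<subseteq> (\<Union>\<alpha>\<in>Ink n k. Pr \<alpha> -` Y \<alpha> \<inter> space (Xa X {1..n})))"

definition Psi :: "(nat \<Rightarrow> 'a topology) \<Rightarrow> nat \<Rightarrow> nat \<Rightarrow>
    (nat set \<Rightarrow> (nat \<Rightarrow> 'a) measure) \<Rightarrow> ((nat \<Rightarrow> 'a) \<Rightarrow> ereal) \<Rightarrow>
    (nat set \<Rightarrow> (nat \<Rightarrow> 'a) \<Rightarrow> real) set" where
  "Psi X n k \<mu>a c = {f. (\<forall>\<alpha>\<in>Ink n k. integrable (\<mu>a \<alpha>) (f \<alpha>)) \<and>
     (\<exists>A. zero_thickness X n k \<mu>a A \<and>
        (\<forall>x\<in>space (Xa X {1..n}) - A. ereal (\<Sum>\<alpha>\<in>Ink n k. f \<alpha> (Pr \<alpha> x)) \<le> c x))}"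

end

theory Submission
  imports Defs
begin

text \<open>Uniform equivalence with a product measure \<open>P\<close> lets a sum of functions of \<open>k\<close> coordinates be
  decomposed again so that each summand is bounded in \<open>L\<^sup>1(P)\<close> by a multiple of the sum: one averages
  over the complementary coordinates. Hence a maximising sequence may be taken bounded
  in \<open>L\<^sup>1\<close>. Convex combinations of its tails converge almost everywhere, separately for each
  \<open>\<alpha>\<close>, so convergence fails only on a set of zero \<open>(n,k)\<close>-thickness, and Fatou's lemma applied to
  \<open>\<Sum>\<alpha>. c\<^sub>\<alpha> - f\<^sub>\<alpha> \<ge> 0\<close> shows that the limit is optimal.\<close>

section \<open>Almost everywhere convergent convex selections\<close>

text \<open>Zero thickness is stronger than being null: for \<open>k = 1\<close> and Lebesgue
  measure, the diagonal of the unit square is null, yet no two null cylinders cover it. An almost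
  everywhere limit of the sums alone is therefore of no use: every summand must converge off a null
  cylinder of its own, and every change of decomposition must preserve the sum at all points. The
  summands of a given sum are far from unique, since a function of shared coordinates can be added
  to one and subtracted from another; so an L1 bound on the sum says nothing about them until they
  are chosen anew. The product measure permits that choice, because averaging over coordinates
  independent of the rest keeps a function of the coordinates in \<alpha> of that form. Each summand
  is then split into a difference of two nonnegative functions, because the selection argument works
  with integrals of \<open>exp (- v)\<close>, which stay bounded only when \<open>v\<close> is
  bounded below.\<close>

lemma limit_of_nonneg_integrable:
  fixes u :: "nat \<Rightarrow> 'a \<Rightarrow> real"
  assumes int: "\<And>m. integrable M (u m)"
    and nonneg: "\<And>m. AE x in M. 0 \<le> u m x"
    and bd: "\<And>m. integral\<^sup>L M (u m) \<le> K m"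
    and K: "K \<longlonglongrightarrow> L"
    and lim: "AE x in M. (\<lambda>m. u m x) \<longlonglongrightarrow> v x"
    and v: "v \<in> borel_measurable M"
  shows "integrable M v" "integral\<^sup>L M v \<le> L"
proof -
  have [measurable]: "u m \<in> borel_measurable M" for m using int by auto
  have ae_nonneg: "AE x in M. \<forall>m. 0 \<le> u m x" using nonneg by (simp add: AE_all_countable)
  have v_nonneg: "AE x in M. 0 \<le> v x"
    using ae_nonneg lim by eventually_elim (auto intro: LIMSEQ_le_const)
  \<comment> \<open>\<open>ennreal\<close> truncates negative reals to 0, so the final estimate can
    be read back in the reals only for a nonnegative bound.\<close>
  have L: "0 \<le> L"
  proof (rule LIMSEQ_le_const[OF K], intro exI allI impI)
    fix m show "0 \<le> K m"
      using integral_nonneg_AE[OF nonneg[of m]] bd[of m] by linarith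
  qed
  have "(\<integral>\<^sup>+x. ennreal (v x) \<partial>M) = (\<integral>\<^sup>+x. liminf (\<lambda>m. ennreal (u m x)) \<partial>M)"
  proof (rule nn_integral_cong_AE)
    show "AE x in M. ennreal (v x) = liminf (\<lambda>m. ennreal (u m x))"
      using lim
    proof eventually_elim
      case (elim x)
      have "(\<lambda>m. ennreal (u m x)) \<longlonglongrightarrow> ennreal (v x)" using elim by (rule tendsto_ennrealI)
      then show ?case by (simp add: lim_imp_Liminf)
    qed
  qed
  also have "\<dots> \<le> liminf (\<lambda>m. \<integral>\<^sup>+x. ennreal (u m x) \<partial>M)"
    by (rule nn_integral_liminf) simp
  also have "\<dots> \<le> liminf (\<lambda>m. ennreal (K m))"
  proof (rule Liminf_mono, rule always_eventually, rule allI)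
    fix m
    show "(\<integral>\<^sup>+x. ennreal (u m x) \<partial>M) \<le> ennreal (K m)"
      using nn_integral_eq_integral[OF int nonneg, of m] bd[of m] by (simp add: ennreal_leI)
  qed
  also have "\<dots> = ennreal L"
    by (rule lim_imp_Liminf) (auto intro: tendsto_ennrealI K)
  finally have *: "(\<integral>\<^sup>+x. ennreal (v x) \<partial>M) \<le> ennreal L" .
  have "(\<integral>\<^sup>+x. ennreal (v x) \<partial>M) < \<infinity>"
    using le_less_trans[OF * ennreal_less_top] by simp
  then show "integrable M v" by (rule integrableI_nonneg[OF v v_nonneg])
  then show "integral\<^sup>L M v \<le> L"
    using * L nn_integral_eq_integral[OF _ v_nonneg] by simp
qed

text \<open>Beppo Levi: the series of absolute values has finite integral, hence is finite almost
  everywhere.\<close>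

lemma AE_summable_of_summable_integral:
  fixes u :: "nat \<Rightarrow> 'a \<Rightarrow> real"
  assumes int: "\<And>m. integrable M (u m)"
    and bd: "\<And>m. (\<integral>x. \<bar>u m x\<bar> \<partial>M) \<le> K m" and K: "summable K"
  shows "AE x in M. summable (\<lambda>m. u m x)"
proof -
  have [measurable]: "u m \<in> borel_measurable M" for m using int by auto
  have K0: "0 \<le> K m" for m
    by (rule order_trans[OF _ bd]) simp
  have "(\<integral>\<^sup>+x. (\<Sum>m. ennreal \<bar>u m x\<bar>) \<partial>M) = (\<Sum>m. \<integral>\<^sup>+x. ennreal \<bar>u m x\<bar> \<partial>M)"
    by (rule nn_integral_suminf) simp
  also have "\<dots> \<le> (\<Sum>m. ennreal (K m))"
  proof (rule suminf_le)
    fix m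
    show "(\<integral>\<^sup>+x. ennreal \<bar>u m x\<bar> \<partial>M) \<le> ennreal (K m)"
      using nn_integral_eq_integral[of M "\<lambda>x. \<bar>u m x\<bar>"] int[of m] bd[of m] by (simp add: ennreal_leI)
  qed auto
  also have "\<dots> < \<infinity>" using K K0 by (simp add: suminf_ennreal2)
  finally have "AE x in M. (\<Sum>m. ennreal \<bar>u m x\<bar>) \<noteq> \<infinity>"
    by (intro nn_integral_PInf_AE) (auto simp: top_unique less_top)
  then show ?thesis
  proof eventually_elim
    case (elim x)
    then have "summable (\<lambda>m. \<bar>u m x\<bar>)" by (intro summable_suminf_not_top) auto
    then show ?case by (rule summable_rabs_cancel)
  qed
qed

text \<open>Telescoping makes \<open>exp (- w m / 2)\<close> converge, and the logarithm carries a
  positive limit back to \<open>w\<close>. A limit 0 would force \<open>w\<close> to infinity, which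
  the hypothesis on the liminf rules out.\<close>

lemma convergent_of_exp_summable:
  fixes w :: "nat \<Rightarrow> real"
  assumes s: "summable (\<lambda>m. exp (- w (Suc m) / 2) - exp (- w m / 2))"
    and l: "liminf (\<lambda>m. ennreal (w m)) \<noteq> \<infinity>"
  shows "convergent w"
proof -
  define e where "e m = exp (- w m / 2)" for m
  have "(\<lambda>m. \<Sum>i<m. e (Suc i) - e i) \<longlonglongrightarrow> (\<Sum>m. e (Suc m) - e m)"
    using summable_LIMSEQ[OF s] by (simp add: e_def)
  then have "(\<lambda>m. (e m - e 0) + e 0) \<longlonglongrightarrow> (\<Sum>m. e (Suc m) - e m) + e 0"
    unfolding sum_lessThan_telescope by (intro tendsto_add tendsto_const)
  then obtain u where u: "e \<longlonglongrightarrow> u" by auto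
  have u0: "0 \<le> u" by (rule LIMSEQ_le_const[OF u]) (auto simp: e_def)
  have w: "w m = - 2 * ln (e m)" for m by (simp add: e_def)
  show ?thesis
  proof (cases "u = 0")
    case False
    then have "(\<lambda>m. - 2 * ln (e m)) \<longlonglongrightarrow> - 2 * ln u" by (intro tendsto_intros u)
    then show ?thesis unfolding w[symmetric] by (auto simp: convergent_def)
  next
    case True
    have "filterlim e (at_right 0) sequentially"
      using u True by (auto simp: filterlim_at e_def)
    then have "filterlim (\<lambda>m. ln (e m)) at_bot sequentially"
      by (rule filterlim_compose[OF ln_at_0])
    then have "filterlim (\<lambda>m. 2 * (- ln (e m))) at_top sequentially"
      by (intro filterlim_tendsto_pos_mult_at_top[OF tendsto_const])
         (auto simp: filterlim_uminus_at_top)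
    moreover have "(\<lambda>m. 2 * (- ln (e m))) = w" by (simp add: w fun_eq_iff)
    ultimately have "filterlim w at_top sequentially" by simp
    then have "(\<lambda>m. ennreal (w m)) \<longlonglongrightarrow> \<infinity>"
      
      by (simp add: ennreal_tendsto_top_eq_at_top)
    then have "liminf (\<lambda>m. ennreal (w m)) = \<infinity>" by (simp add: lim_imp_Liminf)
    with l show ?thesis by simp
  qed
qed


text \<open>A parallelogram identity: the convexity defect of exp(-t) at a midpoint is exactly a
  squared distance between half exponentials. Integrated, it makes near-minimisers close in L2 after
  the change of variable.\<close>

lemma midpoint_exp_gap:
  fixes a b :: real
  shows "exp (- a) + exp (- b) - 2 * exp (- ((a + b) / 2)) = (exp (- a / 2) - exp (- b / 2))\<^sup>2"
proof -
  have "exp (- a) = (exp (- a / 2))\<^sup>2" "exp (- b) = (exp (- b / 2))\<^sup>2"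
    "exp (- ((a + b) / 2)) = exp (- a / 2) * exp (- b / 2)"
    by (simp_all add: power2_eq_square field_simps flip: exp_add)
  then show ?thesis by (simp add: power2_eq_square algebra_simps)
qed

text \<open>A Komlos-type selection: near-minimisers of the strictly convex functional
  \<open>v \<mapsto> \<Sum>j. \<integral> exp (- v j)\<close> form a Cauchy sequence after the change of variable
  \<open>exp (- v / 2)\<close>, and Fatou's lemma excludes the limit \<open>0\<close>.\<close>

lemma (in finite_measure) convex_ae_convergent_selection:
  fixes S :: "nat \<Rightarrow> ('j \<Rightarrow> 'a \<Rightarrow> real) set"
  assumes fin: "finite T" and dec: "decseq S" and ne: "\<And>m. S m \<noteq> {}"
    and mid: "\<And>m v w. v \<in> S m \<Longrightarrow> w \<in> S m \<Longrightarrow> (\<lambda>j x. (v j x + w j x) / 2) \<in> S m"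
    and int: "\<And>v j. v \<in> S 0 \<Longrightarrow> j \<in> T \<Longrightarrow> integrable M (v j)"
    and nonneg: "\<And>v j x. v \<in> S 0 \<Longrightarrow> j \<in> T \<Longrightarrow> x \<in> space M \<Longrightarrow> 0 \<le> v j x"
    and bd: "\<And>v j. v \<in> S 0 \<Longrightarrow> j \<in> T \<Longrightarrow> integral\<^sup>L M (v j) \<le> K"
  obtains w where "\<And>m. w m \<in> S m" and "\<And>j. j \<in> T \<Longrightarrow> AE x in M. convergent (\<lambda>m. w m j x)"
proof -
  have S_mono: "v \<in> S m" if "v \<in> S l" "m \<le> l" for v m l
    using decseqD[OF dec that(2)] that(1) by auto
  have S0: "v \<in> S 0" if "v \<in> S m" for v m using S_mono[OF that] by simp
  define \<Phi> where "\<Phi> v = (\<Sum>j\<in>T. \<integral>x. exp (- v j x) \<partial>M)" for v :: "'j \<Rightarrow> 'a \<Rightarrow> real"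
  have int_exp: "integrable M (\<lambda>x. exp (- v j x))" if "v \<in> S 0" "j \<in> T" for v j
    by (rule integrable_const_bound[where B=1])
       (use nonneg[OF that] int[OF that] in \<open>auto intro!: AE_I2\<close>)
  have \<Phi>0: "0 \<le> \<Phi> v" for v unfolding \<Phi>_def by (intro sum_nonneg integral_nonneg_AE) auto
  have \<Phi>B: "\<Phi> v \<le> (\<Sum>j\<in>T. measure M (space M))" if "v \<in> S 0" for v
    unfolding \<Phi>_def
  proof (rule sum_mono)
    fix j assume j: "j \<in> T"
    have "(\<integral>x. exp (- v j x) \<partial>M) \<le> (\<integral>x. 1 \<partial>M)"
      by (rule integral_mono[OF int_exp[OF that j]]) (use nonneg[OF that j] in auto)
    then show "(\<integral>x. exp (- v j x) \<partial>M) \<le> measure M (space M)" by simp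
  qed
  define I where "I m = Inf (\<Phi> ` S m)" for m
  have I_le: "I m \<le> \<Phi> v" if "v \<in> S m" for m v
    unfolding I_def using that \<Phi>0 by (intro cInf_lower) (auto intro!: bdd_belowI[of _ 0])
  have I_mono: "incseq I"
    unfolding incseq_def I_def
    by (intro allI impI cInf_superset_mono) (auto simp: ne intro: S_mono bdd_belowI[of _ 0] \<Phi>0)
  have I_bdd: "I m \<le> (\<Sum>j\<in>T. measure M (space M))" for m
    using ne[of m] I_le \<Phi>B S0 by (meson all_not_in_conv order_trans)
  obtain I' where I': "I \<longlonglongrightarrow> I'" and I_le': "\<And>m. I m \<le> I'"
    using incseq_convergent[OF I_mono, of "\<Sum>j\<in>T. measure M (space M)"] I_bdd by auto
  \<comment> \<open>The rate 1/4 leaves room for the factor \<open>2 ^ m\<close> that is lost below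
    when L2 bounds are turned into L1 bounds.\<close>
  define \<delta> where "\<delta> m = (1/4::real) ^ m" for m
  have \<delta>: "\<delta> m > 0" "\<delta> (Suc m) \<le> \<delta> m" for m by (auto simp: \<delta>_def)
  \<comment> \<open>Going so late that the infimum over \<open>S r\<close> has nearly reached its
    limit makes near-minimisers of different constraint sets comparable.\<close>
  have "\<exists>r v. m \<le> r \<and> I' - \<delta> m < I r \<and> v \<in> S r \<and> \<Phi> v < I r + \<delta> m" for m
  proof -
    have "\<forall>\<^sub>F r in sequentially. I' - \<delta> m < I r"
      using order_tendstoD(1)[OF I', of "I' - \<delta> m"] \<delta>(1)[of m] by simp
    then obtain r where r: "m \<le> r" "I' - \<delta> m < I r"
      unfolding eventually_sequentially by (meson nle_le)
    have "\<exists>y\<in>\<Phi> ` S r. y < I r + \<delta> m"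
      by (rule cInf_lessD) (use ne[of r] \<delta>(1)[of m] in \<open>auto simp: I_def\<close>)
    with r show ?thesis by auto
  qed
  then obtain r w where r: "\<And>m. m \<le> r m" "\<And>m. I' - \<delta> m < I (r m)"
    and w: "\<And>m. w m \<in> S (r m)" "\<And>m. \<Phi> (w m) < I (r m) + \<delta> m"
    by metis
  have w0: "w m \<in> S 0" for m using S0 w(1) .
  define d where "d m j x = exp (- w (Suc m) j x / 2) - exp (- w m j x / 2)" for m j x
  have w_meas[measurable]: "w m j \<in> borel_measurable M" if "j \<in> T" for m j
    using int[OF w0 that] by auto
  have d_le: "\<bar>d m j x\<bar> \<le> 1" if "j \<in> T" "x \<in> space M" for m j x
  proof -
    have "0 < exp (- w i j x / 2)" "exp (- w i j x / 2) \<le> 1" for i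
      using nonneg[OF w0 that] by auto
    from this[of m] this[of "Suc m"] show ?thesis unfolding d_def by linarith
  qed
  have int_d: "integrable M (d m j)" if j: "j \<in> T" for m j
    by (rule integrable_const_bound[where B=1])
       (use d_le[OF j] w_meas[OF j] in \<open>auto intro!: AE_I2 simp: d_def[abs_def]\<close>)
  have int_d2: "integrable M (\<lambda>x. (d m j x)\<^sup>2)" if j: "j \<in> T" for m j
    by (rule integrable_const_bound[where B=1])
       (use d_le[OF j] w_meas[OF j] in \<open>auto intro!: AE_I2 simp: d_def[abs_def] abs_square_le_1\<close>)
  have sum_d2: "(\<Sum>j\<in>T. \<integral>x. (d m j x)\<^sup>2 \<partial>M) \<le> 4 * \<delta> m" for m
  proof -
    \<comment> \<open>\<open>r\<close> need not be monotone. The larger of the two constraint sets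
      contains both functions and hence their midpoint, whose value is at least \<open>I l\<close>;
      both choices of \<open>r\<close> keep this above \<open>I' - \<delta> m\<close>.\<close>
    define l where "l = min (r m) (r (Suc m))"
    have wl: "w m \<in> S l" "w (Suc m) \<in> S l"
      using w(1) S_mono unfolding l_def by (meson min.cobounded1 min.cobounded2)+
    define u where "u = (\<lambda>j x. (w (Suc m) j x + w m j x) / 2)"
    have u: "u \<in> S l" unfolding u_def by (rule mid[OF wl(2,1)])
    have "I' - \<delta> m < I l"
      using r(2)[of m] r(2)[of "Suc m"] \<delta>(2)[of m] by (auto simp: l_def min_def)
    then have lo: "I' - \<delta> m < \<Phi> u" using I_le[OF u] by linarith
    have hi: "\<Phi> (w m) < I' + \<delta> m" "\<Phi> (w (Suc m)) < I' + \<delta> m"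
      using w(2)[of m] w(2)[of "Suc m"] I_le'[of "r m"] I_le'[of "r (Suc m)"] \<delta>(2)[of m] by linarith+
    have "(\<integral>x. (d m j x)\<^sup>2 \<partial>M) =
        (\<integral>x. exp (- w (Suc m) j x) \<partial>M) + (\<integral>x. exp (- w m j x) \<partial>M) - 2 * (\<integral>x. exp (- u j x) \<partial>M)"
      if j: "j \<in> T" for j
    proof -
      have "(d m j x)\<^sup>2 = exp (- w (Suc m) j x) + exp (- w m j x) - 2 * exp (- u j x)" for x
        using midpoint_exp_gap[of "w (Suc m) j x" "w m j x"] by (simp add: d_def u_def)
      then show ?thesis
        using int_exp[OF w0 j] int_exp[OF S0[OF u] j] by simp
    qed
    then have "(\<Sum>j\<in>T. \<integral>x. (d m j x)\<^sup>2 \<partial>M) = \<Phi> (w (Suc m)) + \<Phi> (w m) - 2 * \<Phi> u"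
      by (simp add: \<Phi>_def sum.distrib sum_subtractf sum_distrib_left)
    \<comment> \<open>Each endpoint is below \<open>I' + \<delta> m\<close> and the midpoint above
      \<open>I' - \<delta> m\<close>, which gives the factor 4.\<close>
    then show ?thesis using lo hi by linarith
  qed
  have "AE x in M. convergent (\<lambda>m. w m j x)" if j: "j \<in> T" for j
  proof -
    define \<kappa> where "\<kappa> m = (4 + measure M (space M)) * (1/2) ^ m" for m :: nat
    have "(\<integral>x. \<bar>d m j x\<bar> \<partial>M) \<le> \<kappa> m" for m
    proof -
      have "(\<integral>x. (d m j x)\<^sup>2 \<partial>M) \<le> (\<Sum>j\<in>T. \<integral>x. (d m j x)\<^sup>2 \<partial>M)"
        by (rule member_le_sum[OF j _ fin]) auto
      with sum_d2[of m] have b: "(\<integral>x. (d m j x)\<^sup>2 \<partial>M) \<le> 4 * \<delta> m" by linarith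
      \<comment> \<open>Weighted Young inequality; the weight \<open>2 ^ m\<close> balances
        \<open>4 * \<delta> m\<close> against the total mass, so both terms decay like
        \<open>(1/2) ^ m\<close>.\<close>
      have "\<bar>t\<bar> \<le> 2 ^ m * t\<^sup>2 + (1/2) ^ m" for t :: real
      proof -
        have "0 \<le> (2 ^ m * \<bar>t\<bar> - 1 / 2)\<^sup>2" by simp
        then have "2 ^ m * \<bar>t\<bar> \<le> (2 ^ m)\<^sup>2 * t\<^sup>2 + 1"
          by (simp add: power2_diff power_mult_distrib power_one_over)
        then have "2 ^ m * \<bar>t\<bar> \<le> 2 ^ m * (2 ^ m * t\<^sup>2 + (1/2) ^ m)"
          by (simp add: power2_eq_square algebra_simps flip: power_mult_distrib)
        then show ?thesis by simp
      qed
      then have "(\<integral>x. \<bar>d m j x\<bar> \<partial>M) \<le> (\<integral>x. 2 ^ m * (d m j x)\<^sup>2 + (1/2) ^ m \<partial>M)"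
        using int_d[OF j] int_d2[OF j] by (intro integral_mono) auto
      also have "\<dots> = 2 ^ m * (\<integral>x. (d m j x)\<^sup>2 \<partial>M) + (1/2) ^ m * measure M (space M)"
        using int_d2[OF j] by simp
      also have "\<dots> \<le> 2 ^ m * (4 * \<delta> m) + (1/2) ^ m * measure M (space M)"
        using b by simp
      also have "2 ^ m * (4 * \<delta> m) = 4 * (1/2) ^ m"
        by (simp add: \<delta>_def flip: power_mult_distrib)
      finally show ?thesis by (simp add: \<kappa>_def algebra_simps)
    qed
    moreover have "summable \<kappa>" unfolding \<kappa>_def by (intro summable_mult summable_geometric) simp
    ultimately have s: "AE x in M. summable (\<lambda>m. d m j x)"
      by (intro AE_summable_of_summable_integral[OF int_d[OF j]])
    \<comment> \<open>The uniform bound \<open>K\<close> on the integrals enters here only: it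
      prevents escape to infinity on a set of positive measure.\<close>
    have "(\<integral>\<^sup>+x. liminf (\<lambda>m. ennreal (w m j x)) \<partial>M) \<le> liminf (\<lambda>m. \<integral>\<^sup>+x. ennreal (w m j x) \<partial>M)"
      by (rule nn_integral_liminf) (use w_meas[OF j] in simp)
    also have "\<dots> \<le> liminf (\<lambda>m. ennreal K)"
    proof (rule Liminf_mono, rule always_eventually, rule allI)
      fix m
      have "(\<integral>\<^sup>+x. ennreal (w m j x) \<partial>M) = ennreal (\<integral>x. w m j x \<partial>M)"
        by (rule nn_integral_eq_integral[OF int[OF w0 j]]) (use nonneg[OF w0 j] in \<open>auto intro!: AE_I2\<close>)
      then show "(\<integral>\<^sup>+x. ennreal (w m j x) \<partial>M) \<le> ennreal K" using bd[OF w0 j, of m] by (simp add: ennreal_leI)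
    qed
    also have "\<dots> < \<infinity>" by (simp add: Liminf_const)
    finally have "AE x in M. liminf (\<lambda>m. ennreal (w m j x)) \<noteq> \<infinity>"
      by (intro nn_integral_PInf_AE) (use w_meas[OF j] in \<open>auto simp: less_top\<close>)
    with s show ?thesis
      unfolding d_def by eventually_elim (rule convergent_of_exp_summable)
  qed
  moreover have "w m \<in> S m" for m using S_mono[OF w(1) r(1)] .
  ultimately show ?thesis using that by blast
qed

section \<open>Sums of cylindrical functions\<close>

text \<open>Keeps all summands on one space with one measure instead of on the various partial
  products. The condition is demanded at every point of \<Omega>, not almost everywhere, and with
  Boolean values it also describes cylinder sets.\<close>

definition cylindrical :: "(nat \<Rightarrow> 'a) set \<Rightarrow> nat set \<Rightarrow> ((nat \<Rightarrow> 'a) \<Rightarrow> 'b) \<Rightarrow> bool" where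
  "cylindrical \<Omega> \<alpha> g \<longleftrightarrow> (\<forall>x\<in>\<Omega>. \<forall>y\<in>\<Omega>. restrict x \<alpha> = restrict y \<alpha> \<longrightarrow> g x = g y)"

lemma cylindricalI:
  "(\<And>x y. x \<in> \<Omega> \<Longrightarrow> y \<in> \<Omega> \<Longrightarrow> restrict x \<alpha> = restrict y \<alpha> \<Longrightarrow> g x = g y) \<Longrightarrow> cylindrical \<Omega> \<alpha> g"
  unfolding cylindrical_def by blast

lemma cylindricalD:
  "cylindrical \<Omega> \<alpha> g \<Longrightarrow> x \<in> \<Omega> \<Longrightarrow> y \<in> \<Omega> \<Longrightarrow> restrict x \<alpha> = restrict y \<alpha> \<Longrightarrow> g x = g y"
  unfolding cylindrical_def by blast

section \<open>Averaging over complementary coordinates in a product space\<close>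

locale nat_product_prob_space = finite_product_prob_space M I
  for M :: "nat \<Rightarrow> 'a measure" and I :: "nat set"
begin

abbreviation "P \<equiv> PiM I M"

text \<open>For integrable \<open>g\<close> this is a version of the conditional expectation given
  the coordinates in \<gamma>, fixed at every point: the Bochner integral is 0 where the section is
  not integrable.\<close>

definition partial_integral :: "nat set \<Rightarrow> ((nat \<Rightarrow> 'a) \<Rightarrow> real) \<Rightarrow> (nat \<Rightarrow> 'a) \<Rightarrow> real" where
  "partial_integral \<gamma> g x = (\<integral>y. g (merge \<gamma> (I - \<gamma>) (x, y)) \<partial>PiM (I - \<gamma>) M)"

context
  fixes \<gamma> :: "nat set"
  assumes \<gamma>: "\<gamma> \<subseteq> I"
begin

lemma finite_\<gamma>: "finite \<gamma>" "finite (I - \<gamma>)"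
  using \<gamma> finite_index by (auto intro: finite_subset)

lemma merge_in_space:
  "x \<in> space P \<Longrightarrow> y \<in> space (PiM (I - \<gamma>) M) \<Longrightarrow> merge \<gamma> (I - \<gamma>) (x, y) \<in> space P"
  using \<gamma> by (auto simp: space_PiM PiE_iff merge_def extensional_def)

lemma integrable_merge:
  assumes "integrable P g"
  shows "integrable (PiM \<gamma> M \<Otimes>\<^sub>M PiM (I - \<gamma>) M) (\<lambda>z. g (merge \<gamma> (I - \<gamma>) z))"
    and "(\<integral>z. \<bar>g (merge \<gamma> (I - \<gamma>) z)\<bar> \<partial>(PiM \<gamma> M \<Otimes>\<^sub>M PiM (I - \<gamma>) M)) = (\<integral>x. \<bar>g x :: real\<bar> \<partial>P)"
proof -
  have eq: "\<gamma> \<union> (I - \<gamma>) = I" using \<gamma> by auto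
  have d: "distr (PiM \<gamma> M \<Otimes>\<^sub>M PiM (I - \<gamma>) M) P (merge \<gamma> (I - \<gamma>)) = P"
    using distr_merge[of \<gamma> "I - \<gamma>"] finite_\<gamma> unfolding eq by auto
  have m: "merge \<gamma> (I - \<gamma>) \<in> PiM \<gamma> M \<Otimes>\<^sub>M PiM (I - \<gamma>) M \<rightarrow>\<^sub>M P"
    using measurable_merge[of \<gamma> "I - \<gamma>" M] unfolding eq .
  show "integrable (PiM \<gamma> M \<Otimes>\<^sub>M PiM (I - \<gamma>) M) (\<lambda>z. g (merge \<gamma> (I - \<gamma>) z))"
    using integrable_distr[OF m, of g] assms d by simp
  show "(\<integral>z. \<bar>g (merge \<gamma> (I - \<gamma>) z)\<bar> \<partial>(PiM \<gamma> M \<Otimes>\<^sub>M PiM (I - \<gamma>) M)) = (\<integral>x. \<bar>g x\<bar> \<partial>P)"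
    using integral_distr[OF m, of "\<lambda>x. \<bar>g x\<bar>"] assms d by simp
qed

lemma merge_restrict: "merge \<gamma> (I - \<gamma>) (restrict x \<gamma>, y) = merge \<gamma> (I - \<gamma>) (x, y)"
  by (auto simp: merge_def)

lemma restrict_distr: "distr P (PiM \<gamma> M) (\<lambda>x. restrict x \<gamma>) = PiM \<gamma> M"
  using distr_restrict[OF \<gamma>] finite_index by simp

text \<open>Fubini on the factors, pulled back along the restriction map. Since it excludes a null
  set of sections, partial integrals are additive only almost everywhere.\<close>

lemma AE_section_integrable:
  assumes "integrable P g"
  shows "AE x in P. integrable (PiM (I - \<gamma>) M) (\<lambda>y. g (merge \<gamma> (I - \<gamma>) (x, y)) :: real)"
proof -
  interpret A: prob_space "PiM \<gamma> M" by (intro prob_space_PiM) (rule M.prob_space_axioms)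
  interpret B: prob_space "PiM (I - \<gamma>) M" by (intro prob_space_PiM) (rule M.prob_space_axioms)
  interpret AB: pair_prob_space "PiM \<gamma> M" "PiM (I - \<gamma>) M" ..
  have "AE x in PiM \<gamma> M. integrable (PiM (I - \<gamma>) M) (\<lambda>y. g (merge \<gamma> (I - \<gamma>) (x, y)))"
    using AB.AE_integrable_fst'[OF integrable_merge(1)[OF assms]] by simp
  then have "AE x in distr P (PiM \<gamma> M) (\<lambda>x. restrict x \<gamma>).
      integrable (PiM (I - \<gamma>) M) (\<lambda>y. g (merge \<gamma> (I - \<gamma>) (x, y)))"
    unfolding restrict_distr .
  from AE_distrD[OF _ this] show ?thesis
    using \<gamma> by (simp add: merge_restrict measurable_restrict_subset)
qed

text \<open>Averaging contracts L1: the absolute value moves inside the inner integral, and Fubini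
  reassembles the norm of \<open>g\<close>.\<close>

lemma integrable_partial_integral:
  assumes "integrable P g"
  shows "integrable P (partial_integral \<gamma> g)"
    and "(\<integral>x. \<bar>partial_integral \<gamma> g x\<bar> \<partial>P) \<le> (\<integral>x. \<bar>g x\<bar> \<partial>P)"
proof -
  interpret A: prob_space "PiM \<gamma> M" by (intro prob_space_PiM) (rule M.prob_space_axioms)
  interpret B: prob_space "PiM (I - \<gamma>) M" by (intro prob_space_PiM) (rule M.prob_space_axioms)
  interpret AB: pair_prob_space "PiM \<gamma> M" "PiM (I - \<gamma>) M" ..
  let ?G = "\<lambda>z. g (merge \<gamma> (I - \<gamma>) z)"
  note G = integrable_merge[OF assms]
  have r: "(\<lambda>x. restrict x \<gamma>) \<in> P \<rightarrow>\<^sub>M PiM \<gamma> M" using \<gamma> by (rule measurable_restrict_subset)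
  have H: "integrable (PiM \<gamma> M) (partial_integral \<gamma> g)"
    using AB.integrable_fst'[OF G(1)] unfolding partial_integral_def .
  have r_eq: "partial_integral \<gamma> g (restrict x \<gamma>) = partial_integral \<gamma> g x" for x
    by (simp add: partial_integral_def merge_restrict)
  show "integrable P (partial_integral \<gamma> g)"
    using integrable_distr[OF r, of "partial_integral \<gamma> g"] H by (simp add: restrict_distr r_eq)
  have "(\<integral>x. \<bar>partial_integral \<gamma> g x\<bar> \<partial>P) = (\<integral>x. \<bar>partial_integral \<gamma> g x\<bar> \<partial>PiM \<gamma> M)"
    using integral_distr[OF r, of "\<lambda>x. \<bar>partial_integral \<gamma> g x\<bar>"] H by (simp add: restrict_distr r_eq)
  also have "\<dots> \<le> (\<integral>x. (\<integral>y. \<bar>?G (x, y)\<bar> \<partial>PiM (I - \<gamma>) M) \<partial>PiM \<gamma> M)"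
    unfolding partial_integral_def
  proof (rule integral_mono)
    show "integrable (PiM \<gamma> M) (\<lambda>x. \<bar>\<integral>y. ?G (x, y) \<partial>PiM (I - \<gamma>) M\<bar>)"
      using H unfolding partial_integral_def by simp
    show "integrable (PiM \<gamma> M) (\<lambda>x. \<integral>y. \<bar>?G (x, y)\<bar> \<partial>PiM (I - \<gamma>) M)"
      using AB.integrable_fst'[OF integrable_abs[OF G(1)]] .
  qed (use integral_norm_bound in force)
  also have "\<dots> = (\<integral>x. \<bar>g x\<bar> \<partial>P)"
    using AB.integral_fst'[OF integrable_abs[OF G(1)]] G(2) by simp
  finally show "(\<integral>x. \<bar>partial_integral \<gamma> g x\<bar> \<partial>P) \<le> (\<integral>x. \<bar>g x\<bar> \<partial>P)" .
qed

text \<open>Independence is what counts here: the averaged coordinates are drawn from a law that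
  does not depend on \<open>x\<close>, so no coordinate of \<gamma> outside \<alpha> can enter
  through the average.\<close>

lemma cylindrical_partial_integral:
  assumes "cylindrical (space P) \<alpha> g"
  shows "cylindrical (space P) \<alpha> (partial_integral \<gamma> g)"
proof (rule cylindricalI)
  fix x y assume x: "x \<in> space P" and y: "y \<in> space P" and xy: "restrict x \<alpha> = restrict y \<alpha>"
  have "x i = y i" if "i \<in> \<alpha>" for i using fun_cong[OF xy, of i] that by simp
  then have "g (merge \<gamma> (I - \<gamma>) (x, z)) = g (merge \<gamma> (I - \<gamma>) (y, z))" if "z \<in> space (PiM (I - \<gamma>) M)" for z
    by (intro cylindricalD[OF assms] merge_in_space x y that) (auto simp: merge_def restrict_def)
  then show "partial_integral \<gamma> g x = partial_integral \<gamma> g y"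
    unfolding partial_integral_def by (intro Bochner_Integration.integral_cong) auto
qed

lemma cylindrical_partial_integral_base: "cylindrical (space P) \<gamma> (partial_integral \<gamma> g)"
proof (rule cylindricalI)
  fix x y :: "nat \<Rightarrow> 'a" assume "restrict x \<gamma> = restrict y \<gamma>"
  then have "merge \<gamma> (I - \<gamma>) (x, z) = merge \<gamma> (I - \<gamma>) (y, z)" for z
    by (metis merge_restrict)
  then show "partial_integral \<gamma> g x = partial_integral \<gamma> g y" by (simp add: partial_integral_def)
qed

lemma partial_integral_cylindrical:
  assumes "cylindrical (space P) \<gamma> g" "x \<in> space P"
  shows "partial_integral \<gamma> g x = g x"
proof -
  interpret B: prob_space "PiM (I - \<gamma>) M" by (intro prob_space_PiM) (rule M.prob_space_axioms)
  have "g (merge \<gamma> (I - \<gamma>) (x, z)) = g x" if "z \<in> space (PiM (I - \<gamma>) M)" for z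
    by (intro cylindricalD[OF assms(1)] merge_in_space assms(2) that) (auto simp: merge_def restrict_def)
  then have "partial_integral \<gamma> g x = (\<integral>z. g x \<partial>PiM (I - \<gamma>) M)"
    unfolding partial_integral_def by (intro Bochner_Integration.integral_cong) auto
  then show ?thesis by (simp add: B.prob_space)
qed

lemma AE_partial_integral_sum:
  assumes "finite A" "\<And>\<alpha>. \<alpha> \<in> A \<Longrightarrow> integrable P (g \<alpha>)"
  shows "AE x in P. partial_integral \<gamma> (\<lambda>x. \<Sum>\<alpha>\<in>A. g \<alpha> x) x = (\<Sum>\<alpha>\<in>A. partial_integral \<gamma> (g \<alpha>) x)"
proof -
  have "AE x in P. \<forall>\<alpha>\<in>A. integrable (PiM (I - \<gamma>) M) (\<lambda>y. g \<alpha> (merge \<gamma> (I - \<gamma>) (x, y)))"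
    by (rule AE_finite_allI[OF assms(1)]) (rule AE_section_integrable[OF assms(2)])
  then show ?thesis
    unfolding partial_integral_def
    by eventually_elim (rule Bochner_Integration.integral_sum, blast)
qed

end

text \<open>The coordinates in \<open>\<alpha>\<close> are split off by averaging over the others; averaging the
  identity \<open>F = \<Sum>\<alpha>. g \<alpha>\<close> term by term keeps the decomposition valid at every point, so that no
  exceptional set arises that is null without being covered by null cylinders.\<close>

lemma sum_cylindrical_bounded_decomposition:
  fixes g :: "nat set \<Rightarrow> (nat \<Rightarrow> 'a) \<Rightarrow> real"
  assumes "finite A" "\<And>\<alpha>. \<alpha> \<in> A \<Longrightarrow> \<alpha> \<subseteq> I"
    and "\<And>\<alpha>. \<alpha> \<in> A \<Longrightarrow> integrable P (g \<alpha>)" "\<And>\<alpha>. \<alpha> \<in> A \<Longrightarrow> cylindrical (space P) \<alpha> (g \<alpha>)"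
  obtains h where "\<And>\<alpha>. \<alpha> \<in> A \<Longrightarrow> integrable P (h \<alpha>)" "\<And>\<alpha>. \<alpha> \<in> A \<Longrightarrow> cylindrical (space P) \<alpha> (h \<alpha>)"
    "\<And>x. (\<Sum>\<alpha>\<in>A. h \<alpha> x) = (\<Sum>\<alpha>\<in>A. g \<alpha> x)"
    "\<And>\<alpha>. \<alpha> \<in> A \<Longrightarrow> (\<integral>x. \<bar>h \<alpha> x\<bar> \<partial>P) \<le> 2 ^ card A * (\<integral>x. \<bar>\<Sum>\<alpha>\<in>A. g \<alpha> x\<bar> \<partial>P)"
proof -
  have "\<exists>h. (\<forall>\<alpha>\<in>A. integrable P (h \<alpha>) \<and> cylindrical (space P) \<alpha> (h \<alpha>) \<and>
       (\<integral>x. \<bar>h \<alpha> x\<bar> \<partial>P) \<le> 2 ^ card A * (\<integral>x. \<bar>\<Sum>\<alpha>\<in>A. g \<alpha> x\<bar> \<partial>P)) \<and>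
       (\<forall>x. (\<Sum>\<alpha>\<in>A. h \<alpha> x) = (\<Sum>\<alpha>\<in>A. g \<alpha> x))"
    using assms
  proof (induction A arbitrary: g rule: finite_induct)
    case empty
    show ?case by (intro exI[of _ g]) simp
  next
    case (insert \<beta> A)
    define F where "F x = (\<Sum>\<alpha>\<in>insert \<beta> A. g \<alpha> x)" for x
    \<comment> \<open>Almost everywhere this is the average of \<open>F\<close>, hence small with
      \<open>F\<close>; \<open>g \<beta>\<close> needs no averaging, being a function of the
      coordinates in \<beta> already.\<close>
    define h0 where "h0 x = g \<beta> x + (\<Sum>\<alpha>\<in>A. partial_integral \<beta> (g \<alpha>) x)" for x
    define g' where "g' \<alpha> x = g \<alpha> x - partial_integral \<beta> (g \<alpha>) x" for \<alpha> x
    have \<beta>: "\<beta> \<subseteq> I" and int: "integrable P (g \<beta>)" "\<And>\<alpha>. \<alpha> \<in> A \<Longrightarrow> integrable P (g \<alpha>)"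
      and cyl: "cylindrical (space P) \<beta> (g \<beta>)" "\<And>\<alpha>. \<alpha> \<in> A \<Longrightarrow> cylindrical (space P) \<alpha> (g \<alpha>)"
      using insert.prems by auto
    have int_F: "integrable P F" unfolding F_def[abs_def] using insert.prems(2) by auto
    have int_h0: "integrable P h0" unfolding h0_def[abs_def]
      using int integrable_partial_integral(1)[OF \<beta>] by auto
    have cyl_h0: "cylindrical (space P) \<beta> h0"
    proof (rule cylindricalI)
      fix x y assume xy: "x \<in> space P" "y \<in> space P" "restrict x \<beta> = restrict y \<beta>"
      show "h0 x = h0 y"
        unfolding h0_def
        using cylindricalD[OF cyl(1) xy] cylindricalD[OF cylindrical_partial_integral_base[OF \<beta>] xy]
        by simp
    qed
    have "AE x in P. partial_integral \<beta> F x = (\<Sum>\<alpha>\<in>insert \<beta> A. partial_integral \<beta> (g \<alpha>) x)"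
      unfolding F_def[abs_def] using insert.prems(2) insert.hyps(1)
      by (intro AE_partial_integral_sum[OF \<beta>]) auto
    then have "AE x in P. h0 x = partial_integral \<beta> F x"
      using AE_space
    proof eventually_elim
      case (elim x)
      then show ?case
        using insert.hyps partial_integral_cylindrical[OF \<beta> cyl(1)] by (simp add: h0_def)
    qed
    \<comment> \<open>The almost everywhere identity is used for the norm only; the decomposition
      itself rests on the definitions of \<open>h0\<close> and \<open>g'\<close>, which hold
      pointwise.\<close>
    then have "(\<integral>x. \<bar>h0 x\<bar> \<partial>P) = (\<integral>x. \<bar>partial_integral \<beta> F x\<bar> \<partial>P)"
      using int_h0 integrable_partial_integral(1)[OF \<beta> int_F] by (intro integral_cong_AE) auto
    with integrable_partial_integral(2)[OF \<beta> int_F]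
    have h0_le: "(\<integral>x. \<bar>h0 x\<bar> \<partial>P) \<le> (\<integral>x. \<bar>F x\<bar> \<partial>P)" by simp
    have sum_g': "(\<Sum>\<alpha>\<in>A. g' \<alpha> x) = F x - h0 x" for x
      using insert.hyps by (simp add: g'_def F_def h0_def sum_subtractf)
    \<comment> \<open>Splitting off one index at most doubles the norm of what remains, whence the
      constant \<open>2 ^ card A\<close>.\<close>
    have "(\<integral>x. \<bar>\<Sum>\<alpha>\<in>A. g' \<alpha> x\<bar> \<partial>P) \<le> (\<integral>x. \<bar>F x\<bar> + \<bar>h0 x\<bar> \<partial>P)"
      unfolding sum_g' using int_F int_h0 by (intro integral_mono) auto
    also have "\<dots> \<le> 2 * (\<integral>x. \<bar>F x\<bar> \<partial>P)" using int_F int_h0 h0_le by simp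
    finally have le: "(\<integral>x. \<bar>\<Sum>\<alpha>\<in>A. g' \<alpha> x\<bar> \<partial>P) \<le> 2 * (\<integral>x. \<bar>F x\<bar> \<partial>P)" .
    have "integrable P (g' \<alpha>)" "cylindrical (space P) \<alpha> (g' \<alpha>)" if "\<alpha> \<in> A" for \<alpha>
    proof -
      show "integrable P (g' \<alpha>)" unfolding g'_def[abs_def]
        using int(2)[OF that] integrable_partial_integral(1)[OF \<beta>] by auto
      show "cylindrical (space P) \<alpha> (g' \<alpha>)"
        using cylindricalD[OF cyl(2)[OF that]]
          cylindricalD[OF cylindrical_partial_integral[OF \<beta> cyl(2)[OF that]]]
        unfolding g'_def by (intro cylindricalI arg_cong2[of _ _ _ _ "(-)"]) blast+
    qed
    with insert.IH[of g'] insert.prems(1)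
    obtain h where h: "\<forall>\<alpha>\<in>A. integrable P (h \<alpha>) \<and> cylindrical (space P) \<alpha> (h \<alpha>) \<and>
       (\<integral>x. \<bar>h \<alpha> x\<bar> \<partial>P) \<le> 2 ^ card A * (\<integral>x. \<bar>\<Sum>\<alpha>\<in>A. g' \<alpha> x\<bar> \<partial>P)"
       "\<forall>x. (\<Sum>\<alpha>\<in>A. h \<alpha> x) = (\<Sum>\<alpha>\<in>A. g' \<alpha> x)"
      by auto
    have bd: "(\<integral>x. \<bar>h \<alpha> x\<bar> \<partial>P) \<le> 2 ^ Suc (card A) * (\<integral>x. \<bar>F x\<bar> \<partial>P)" if "\<alpha> \<in> A" for \<alpha>
    proof -
      have "(\<integral>x. \<bar>h \<alpha> x\<bar> \<partial>P) \<le> 2 ^ card A * (2 * (\<integral>x. \<bar>F x\<bar> \<partial>P))"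
        using h(1) that le by (meson mult_left_mono order_trans zero_le_numeral zero_le_power)
      then show ?thesis by simp
    qed
    have "(\<integral>x. \<bar>F x\<bar> \<partial>P) \<le> 2 ^ Suc (card A) * (\<integral>x. \<bar>F x\<bar> \<partial>P)"
      using mult_right_mono[of 1 "2 ^ Suc (card A)" "\<integral>x. \<bar>F x\<bar> \<partial>P"] one_le_power[of "2::real" "Suc (card A)"]
      by simp
    with h0_le have bd0: "(\<integral>x. \<bar>h0 x\<bar> \<partial>P) \<le> 2 ^ Suc (card A) * (\<integral>x. \<bar>F x\<bar> \<partial>P)" by linarith
    have upd: "(\<Sum>\<alpha>\<in>A. (h(\<beta> := h0)) \<alpha> x) = (\<Sum>\<alpha>\<in>A. h \<alpha> x)" for x
      using insert.hyps by (intro sum.cong) auto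
    show ?case
      using h bd bd0 int_h0 cyl_h0 insert.hyps upd sum_g'
      by (intro exI[of _ "h(\<beta> := h0)"]) (auto simp: F_def[symmetric])
  qed
  then show ?thesis using that by blast
qed

end

section \<open>Attainment over a product measure\<close>

context nat_product_prob_space begin

text \<open>\<open>Psi\<close> lifted to the full product: the sets \<open>N \<alpha>\<close> stand
  for the preimages of the null sets \<open>Y \<alpha>\<close> that witness zero thickness.\<close>

definition dual_feasible :: "nat set set \<Rightarrow> ((nat \<Rightarrow> 'a) \<Rightarrow> ereal) \<Rightarrow> (nat set \<Rightarrow> (nat \<Rightarrow> 'a) \<Rightarrow> real) set" where
  "dual_feasible A c = {f. (\<forall>\<alpha>\<in>A. integrable P (f \<alpha>) \<and> cylindrical (space P) \<alpha> (f \<alpha>)) \<and>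
     (\<exists>N. (\<forall>\<alpha>\<in>A. N \<alpha> \<in> null_sets P \<and> cylindrical (space P) \<alpha> (\<lambda>x. x \<in> N \<alpha>)) \<and>
        (\<forall>x\<in>space P. (\<forall>\<alpha>\<in>A. x \<notin> N \<alpha>) \<longrightarrow> ereal (\<Sum>\<alpha>\<in>A. f \<alpha> x) \<le> c x))}"

lemma dual_feasibleI:
  assumes "\<And>\<alpha>. \<alpha> \<in> A \<Longrightarrow> integrable P (f \<alpha>)" "\<And>\<alpha>. \<alpha> \<in> A \<Longrightarrow> cylindrical (space P) \<alpha> (f \<alpha>)"
    and "\<And>\<alpha>. \<alpha> \<in> A \<Longrightarrow> N \<alpha> \<in> null_sets P" "\<And>\<alpha>. \<alpha> \<in> A \<Longrightarrow> cylindrical (space P) \<alpha> (\<lambda>x. x \<in> N \<alpha>)"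
    and "\<And>x. x \<in> space P \<Longrightarrow> (\<And>\<alpha>. \<alpha> \<in> A \<Longrightarrow> x \<notin> N \<alpha>) \<Longrightarrow> ereal (\<Sum>\<alpha>\<in>A. f \<alpha> x) \<le> c x"
  shows "f \<in> dual_feasible A c"
  unfolding dual_feasible_def using assms by (intro CollectI conjI ballI exI[of _ N]) auto

lemma dual_feasibleE:
  assumes "f \<in> dual_feasible A c"
  obtains N where "\<And>\<alpha>. \<alpha> \<in> A \<Longrightarrow> N \<alpha> \<in> null_sets P" "\<And>\<alpha>. \<alpha> \<in> A \<Longrightarrow> cylindrical (space P) \<alpha> (\<lambda>x. x \<in> N \<alpha>)"
    "\<And>x. x \<in> space P \<Longrightarrow> (\<And>\<alpha>. \<alpha> \<in> A \<Longrightarrow> x \<notin> N \<alpha>) \<Longrightarrow> ereal (\<Sum>\<alpha>\<in>A. f \<alpha> x) \<le> c x"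
proof -
  from assms obtain N where "(\<forall>\<alpha>\<in>A. N \<alpha> \<in> null_sets P \<and> cylindrical (space P) \<alpha> (\<lambda>x. x \<in> N \<alpha>)) \<and>
        (\<forall>x\<in>space P. (\<forall>\<alpha>\<in>A. x \<notin> N \<alpha>) \<longrightarrow> ereal (\<Sum>\<alpha>\<in>A. f \<alpha> x) \<le> c x)"
    unfolding dual_feasible_def by auto
  then show thesis by (intro that[of N]) auto
qed

lemma dual_feasible_integrable:
  assumes "f \<in> dual_feasible A c" "\<alpha> \<in> A"
  shows "integrable P (f \<alpha>)" "cylindrical (space P) \<alpha> (f \<alpha>)"
  using assms unfolding dual_feasible_def by auto

lemma dual_feasible_AE:
  assumes "finite A" "f \<in> dual_feasible A c"
  shows "AE x in P. ereal (\<Sum>\<alpha>\<in>A. f \<alpha> x) \<le> c x"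
proof -
  from assms(2) obtain N where N: "\<And>\<alpha>. \<alpha> \<in> A \<Longrightarrow> N \<alpha> \<in> null_sets P"
    "\<And>x. x \<in> space P \<Longrightarrow> (\<And>\<alpha>. \<alpha> \<in> A \<Longrightarrow> x \<notin> N \<alpha>) \<Longrightarrow> ereal (\<Sum>\<alpha>\<in>A. f \<alpha> x) \<le> c x"
    by (elim dual_feasibleE) metis
  have "AE x in P. \<forall>\<alpha>\<in>A. x \<notin> N \<alpha>"
    by (rule AE_finite_allI[OF assms(1)]) (rule AE_not_in[OF N(1)])
  with AE_space show ?thesis by eventually_elim (use N(2) in blast)
qed

lemma dual_feasible_midpoint:
  assumes "f \<in> dual_feasible A c" "g \<in> dual_feasible A c"
  shows "(\<lambda>\<alpha> x. (f \<alpha> x + g \<alpha> x) / 2) \<in> dual_feasible A c"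
proof -
  obtain N where N: "\<And>\<alpha>. \<alpha> \<in> A \<Longrightarrow> N \<alpha> \<in> null_sets P" "\<And>\<alpha>. \<alpha> \<in> A \<Longrightarrow> cylindrical (space P) \<alpha> (\<lambda>x. x \<in> N \<alpha>)"
    "\<And>x. x \<in> space P \<Longrightarrow> (\<And>\<alpha>. \<alpha> \<in> A \<Longrightarrow> x \<notin> N \<alpha>) \<Longrightarrow> ereal (\<Sum>\<alpha>\<in>A. f \<alpha> x) \<le> c x"
    using assms(1) by (elim dual_feasibleE) metis
  obtain N' where N': "\<And>\<alpha>. \<alpha> \<in> A \<Longrightarrow> N' \<alpha> \<in> null_sets P" "\<And>\<alpha>. \<alpha> \<in> A \<Longrightarrow> cylindrical (space P) \<alpha> (\<lambda>x. x \<in> N' \<alpha>)"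
    "\<And>x. x \<in> space P \<Longrightarrow> (\<And>\<alpha>. \<alpha> \<in> A \<Longrightarrow> x \<notin> N' \<alpha>) \<Longrightarrow> ereal (\<Sum>\<alpha>\<in>A. g \<alpha> x) \<le> c x"
    using assms(2) by (elim dual_feasibleE) metis
  note f = dual_feasible_integrable[OF assms(1)] and g = dual_feasible_integrable[OF assms(2)]
  show ?thesis
  proof (rule dual_feasibleI)
    fix \<alpha> assume \<alpha>: "\<alpha> \<in> A"
    show "integrable P (\<lambda>x. (f \<alpha> x + g \<alpha> x) / 2)" using f(1)[OF \<alpha>] g(1)[OF \<alpha>] by simp
    show "cylindrical (space P) \<alpha> (\<lambda>x. (f \<alpha> x + g \<alpha> x) / 2)"
      by (rule cylindricalI) (metis cylindricalD[OF f(2)[OF \<alpha>]] cylindricalD[OF g(2)[OF \<alpha>]])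
    show "N \<alpha> \<union> N' \<alpha> \<in> null_sets P" using N(1)[OF \<alpha>] N'(1)[OF \<alpha>] by blast
    show "cylindrical (space P) \<alpha> (\<lambda>x. x \<in> N \<alpha> \<union> N' \<alpha>)"
      by (rule cylindricalI) (metis cylindricalD[OF N(2)[OF \<alpha>]] cylindricalD[OF N'(2)[OF \<alpha>]] Un_iff)
  next
    fix x assume x: "x \<in> space P" and nx: "\<And>\<alpha>. \<alpha> \<in> A \<Longrightarrow> x \<notin> N \<alpha> \<union> N' \<alpha>"
    have "ereal (\<Sum>\<alpha>\<in>A. f \<alpha> x) \<le> c x" "ereal (\<Sum>\<alpha>\<in>A. g \<alpha> x) \<le> c x"
      using N(3)[OF x] N'(3)[OF x] nx by blast+
    moreover have "(\<Sum>\<alpha>\<in>A. (f \<alpha> x + g \<alpha> x) / 2) = ((\<Sum>\<alpha>\<in>A. f \<alpha> x) + (\<Sum>\<alpha>\<in>A. g \<alpha> x)) / 2"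
      by (simp add: sum.distrib flip: sum_divide_distrib)
    ultimately show "ereal (\<Sum>\<alpha>\<in>A. (f \<alpha> x + g \<alpha> x) / 2) \<le> c x"
      by (cases "c x") auto
  qed
qed

lemma integrable_weighted:
  fixes w f :: "(nat \<Rightarrow> 'a) \<Rightarrow> real"
  assumes "w \<in> borel_measurable P" "\<And>x. x \<in> space P \<Longrightarrow> \<bar>w x\<bar> \<le> b" "integrable P f"
  shows "integrable P (\<lambda>x. f x * w x)"
proof (rule Bochner_Integration.integrable_bound)
  show "integrable P (\<lambda>x. b * f x)" using assms(3) by simp
  show "(\<lambda>x. f x * w x) \<in> borel_measurable P" using assms by auto
  show "AE x in P. norm (f x * w x) \<le> norm (b * f x)"
  proof (rule AE_I2)
    fix x assume "x \<in> space P"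
    from assms(2)[OF this] have "\<bar>w x\<bar> \<le> \<bar>b\<bar>" by linarith
    from mult_left_mono[OF this, of "\<bar>f x\<bar>"] show "norm (f x * w x) \<le> norm (b * f x)"
      by (simp add: abs_mult mult.commute)
  qed
qed

text \<open>The direct method, with \<open>w\<close> in the role of the density of the reducing
  measure. The majorant \<open>G\<close> enters through integrals only, so it may fail on any null
  set, whereas feasibility of the limit has to be checked off null cylinders.\<close>

theorem dual_attained:
  fixes w G :: "(nat \<Rightarrow> 'a) \<Rightarrow> real"
  assumes fin: "finite A" and A: "\<And>\<alpha>. \<alpha> \<in> A \<Longrightarrow> \<alpha> \<subseteq> I"
    and w[measurable]: "w \<in> borel_measurable P" and a: "0 < a"
    and wb: "\<And>x. x \<in> space P \<Longrightarrow> a \<le> w x" "\<And>x. x \<in> space P \<Longrightarrow> w x \<le> b"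
    and G: "integrable P G" and cG: "AE x in P. c x \<le> ereal (G x)"
    and ne: "dual_feasible A c \<noteq> {}"
  shows "\<exists>f\<in>dual_feasible A c. \<forall>h\<in>dual_feasible A c.
    (\<integral>x. (\<Sum>\<alpha>\<in>A. h \<alpha> x) * w x \<partial>P) \<le> (\<integral>x. (\<Sum>\<alpha>\<in>A. f \<alpha> x) * w x \<partial>P)"
proof -
  define val where "val f = (\<integral>x. (\<Sum>\<alpha>\<in>A. f \<alpha> x) * w x \<partial>P)" for f :: "nat set \<Rightarrow> (nat \<Rightarrow> 'a) \<Rightarrow> real"
  define D where "D = dual_feasible A c"
  define s where "s f x = (\<Sum>\<alpha>\<in>A. f \<alpha> x)" for f :: "nat set \<Rightarrow> (nat \<Rightarrow> 'a) \<Rightarrow> real" and x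
  have wabs: "\<bar>w x\<bar> \<le> b" "0 \<le> w x" if "x \<in> space P" for x using wb[OF that] a by auto
  have iw: "integrable P (\<lambda>x. f x * w x)" if "integrable P f" for f
    by (rule integrable_weighted[OF w wabs(1) that])
  have int_s: "integrable P (s f)" if "f \<in> D" for f
    unfolding s_def[abs_def] using dual_feasible_integrable(1) that by (auto simp: D_def)
  have val: "val f = (\<integral>x. s f x * w x \<partial>P)" for f by (simp add: val_def s_def)
  have s_le: "AE x in P. s f x \<le> G x" if "f \<in> D" for f
    using dual_feasible_AE[OF fin that[unfolded D_def]] cG
    by eventually_elim (use order_trans in \<open>fastforce simp: s_def\<close>)
  define Gw where "Gw = (\<integral>x. G x * w x \<partial>P)"
  have gap: "integrable P (\<lambda>x. (G x - s f x) * w x)" "AE x in P. 0 \<le> (G x - s f x) * w x"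
    "(\<integral>x. (G x - s f x) * w x \<partial>P) = Gw - val f" if "f \<in> D" for f
  proof -
    show "integrable P (\<lambda>x. (G x - s f x) * w x)" using iw[OF Bochner_Integration.integrable_diff[OF G int_s[OF that]]] by simp
    show "AE x in P. 0 \<le> (G x - s f x) * w x"
      using s_le[OF that] AE_space by eventually_elim (auto intro!: mult_nonneg_nonneg wabs)
    show "(\<integral>x. (G x - s f x) * w x \<partial>P) = Gw - val f"
      unfolding Gw_def val left_diff_distrib
      by (rule Bochner_Integration.integral_diff[OF iw[OF G] iw[OF int_s[OF that]]])
  qed
  have le_Gw: "val f \<le> Gw" if "f \<in> D" for f
    using integral_nonneg_AE[OF gap(2)[OF that]] gap(3)[OF that] by linarith
  define J where "J = Sup (val ` D)"
  have bdd: "bdd_above (val ` D)" using le_Gw by (auto intro!: bdd_aboveI)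
  have le_J: "val f \<le> J" if "f \<in> D" for f
    unfolding J_def using that bdd by (intro cSup_upper) auto
  have near_J: "\<exists>f\<in>D. J - \<epsilon> < val f" if "0 < \<epsilon>" for \<epsilon>
    using less_cSupD[of "val ` D" "J - \<epsilon>"] ne that unfolding D_def[symmetric] J_def[symmetric] by auto
  \<comment> \<open>From \<open>a * \<bar>s f x\<bar> \<le> (G x - s f x) * w x + \<bar>G x * w
    x\<bar>\<close> almost everywhere: integrated, the first term is \<open>Gw - val f\<close>, at
    most \<open>Gw - J + 1\<close> within distance 1 of the supremum.\<close>
  define R where "R = (Gw - J + 1 + (\<integral>x. \<bar>G x * w x\<bar> \<partial>P)) / a"
  have R: "(\<integral>x. \<bar>s f x\<bar> \<partial>P) \<le> R" if f: "f \<in> D" and v: "J - 1 \<le> val f" for f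
  proof -
    have "AE x in P. a * \<bar>s f x\<bar> \<le> (G x - s f x) * w x + \<bar>G x * w x\<bar>"
      using s_le[OF f] AE_space
    proof eventually_elim
      case (elim x)
      have "a * \<bar>s f x\<bar> \<le> w x * \<bar>s f x\<bar>" using wb(1)[OF elim(2)] by (intro mult_right_mono) auto
      also have "\<dots> = \<bar>G x * w x - (G x - s f x) * w x\<bar>"
        using wabs(2)[OF elim(2)] by (simp add: abs_mult algebra_simps)
      also have "\<dots> \<le> \<bar>(G x - s f x) * w x\<bar> + \<bar>G x * w x\<bar>" by linarith
      also have "\<bar>(G x - s f x) * w x\<bar> = (G x - s f x) * w x"
        using elim(1) wabs(2)[OF elim(2)] by simp
      finally show ?case .
    qed
    then have "(\<integral>x. a * \<bar>s f x\<bar> \<partial>P) \<le> (\<integral>x. (G x - s f x) * w x + \<bar>G x * w x\<bar> \<partial>P)"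
      using int_s[OF f] gap(1)[OF f] iw[OF G] by (intro integral_mono_AE) auto
    also have "\<dots> = Gw - val f + (\<integral>x. \<bar>G x * w x\<bar> \<partial>P)"
      using gap(1)[OF f] iw[OF G] gap(3)[OF f] by simp
    finally have "a * (\<integral>x. \<bar>s f x\<bar> \<partial>P) \<le> Gw - J + 1 + (\<integral>x. \<bar>G x * w x\<bar> \<partial>P)"
      using int_s[OF f] v by simp
    then show ?thesis using a by (simp add: R_def field_simps)
  qed
  define K where "K = 2 ^ card A * R"
  define diff where "diff v \<alpha> x = v (\<alpha>, True) x - v (\<alpha>, False) x"
    for v :: "nat set \<times> bool \<Rightarrow> (nat \<Rightarrow> 'a) \<Rightarrow> real" and \<alpha> x
  \<comment> \<open>The two components for \<alpha> need not be the positive and negative parts of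
    their difference: that property is lost under midpoints, while all conditions imposed here
    survive them.\<close>
  define S where "S m = {v. (\<forall>j\<in>A \<times> UNIV. integrable P (v j) \<and> cylindrical (space P) (fst j) (v j) \<and>
      (\<forall>x. 0 \<le> v j x) \<and> integral\<^sup>L P (v j) \<le> K) \<and> diff v \<in> D \<and> J - 1 / real (Suc m) \<le> val (diff v)}" for m
  have SD: "diff v \<in> D" "J - 1 / real (Suc m) \<le> val (diff v)" if "v \<in> S m" for v m
    using that by (auto simp: S_def)
  have Sv: "integrable P (v j)" "cylindrical (space P) (fst j) (v j)" "0 \<le> v j x" "integral\<^sup>L P (v j) \<le> K"
    if "v \<in> S m" "j \<in> A \<times> UNIV" for v j m x
    using that unfolding S_def by blast+
  have dec: "decseq S"
  proof (rule decseq_SucI, rule subsetI)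
    fix m v assume "v \<in> S (Suc m)"
    moreover have "1 / real (Suc (Suc m)) \<le> 1 / real (Suc m)" by (simp add: field_simps)
    ultimately show "v \<in> S m" unfolding S_def by auto
  qed
  have S_ne: "S m \<noteq> {}" for m
  proof -
    obtain g where g: "g \<in> D" "J - 1 / real (Suc m) < val g" using near_J[of "1 / real (Suc m)"] by auto
    note gi = dual_feasible_integrable[OF g(1)[unfolded D_def]]
    obtain h where h: "\<And>\<alpha>. \<alpha> \<in> A \<Longrightarrow> integrable P (h \<alpha>)" "\<And>\<alpha>. \<alpha> \<in> A \<Longrightarrow> cylindrical (space P) \<alpha> (h \<alpha>)"
      "\<And>x. (\<Sum>\<alpha>\<in>A. h \<alpha> x) = (\<Sum>\<alpha>\<in>A. g \<alpha> x)"
      "\<And>\<alpha>. \<alpha> \<in> A \<Longrightarrow> (\<integral>x. \<bar>h \<alpha> x\<bar> \<partial>P) \<le> 2 ^ card A * (\<integral>x. \<bar>\<Sum>\<alpha>\<in>A. g \<alpha> x\<bar> \<partial>P)"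
      using sum_cylindrical_bounded_decomposition[OF fin A gi] by metis
    have hD: "h \<in> D"
    proof -
      obtain N where N: "\<And>\<alpha>. \<alpha> \<in> A \<Longrightarrow> N \<alpha> \<in> null_sets P" "\<And>\<alpha>. \<alpha> \<in> A \<Longrightarrow> cylindrical (space P) \<alpha> (\<lambda>x. x \<in> N \<alpha>)"
        "\<And>x. x \<in> space P \<Longrightarrow> (\<And>\<alpha>. \<alpha> \<in> A \<Longrightarrow> x \<notin> N \<alpha>) \<Longrightarrow> ereal (\<Sum>\<alpha>\<in>A. g \<alpha> x) \<le> c x"
        using g(1)[unfolded D_def] by (elim dual_feasibleE) metis
      show ?thesis unfolding D_def
        \<comment> \<open>The old null cylinders still serve because the two sums agree at every
          point.\<close>
        by (rule dual_feasibleI[OF h(1,2) N(1,2)]) (simp_all add: h(3) N(3))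
    qed
    have sh: "s h = s g" by (simp add: s_def h(3) fun_eq_iff)
    define v where "v = (\<lambda>(\<alpha>, p) x. if p then max 0 (h \<alpha> x) else max 0 (- h \<alpha> x))"
    have dv: "diff v = h" by (auto simp: diff_def v_def fun_eq_iff)
    have "1 / real (Suc m) \<le> 1" by simp
    then have "(\<integral>x. \<bar>s g x\<bar> \<partial>P) \<le> R" using R[OF g(1)] g(2) by linarith
    then have hK: "(\<integral>x. \<bar>h \<alpha> x\<bar> \<partial>P) \<le> K" if "\<alpha> \<in> A" for \<alpha>
      using h(4)[OF that] unfolding K_def s_def
      by (meson mult_left_mono order_trans zero_le_numeral zero_le_power)
    have "integrable P (v (\<alpha>, p)) \<and> cylindrical (space P) \<alpha> (v (\<alpha>, p)) \<and>
      (\<forall>x. 0 \<le> v (\<alpha>, p) x) \<and> integral\<^sup>L P (v (\<alpha>, p)) \<le> K" if \<alpha>: "\<alpha> \<in> A" for \<alpha> p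
    proof (intro conjI allI)
      show i: "integrable P (v (\<alpha>, p))"
        using h(1)[OF \<alpha>] by (cases p) (auto simp: v_def)
      show "cylindrical (space P) \<alpha> (v (\<alpha>, p))"
        unfolding v_def by (rule cylindricalI) (metis (no_types, lifting) case_prod_conv cylindricalD[OF h(2)[OF \<alpha>]])
      show "0 \<le> v (\<alpha>, p) x" for x by (auto simp: v_def)
      have "integral\<^sup>L P (v (\<alpha>, p)) \<le> (\<integral>x. \<bar>h \<alpha> x\<bar> \<partial>P)"
        using i h(1)[OF \<alpha>] by (intro integral_mono) (auto simp: v_def)
      then show "integral\<^sup>L P (v (\<alpha>, p)) \<le> K" using hK[OF \<alpha>] by linarith
    qed
    then have vj: "\<forall>j\<in>A \<times> UNIV. integrable P (v j) \<and> cylindrical (space P) (fst j) (v j) \<and>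
        (\<forall>x. 0 \<le> v j x) \<and> integral\<^sup>L P (v j) \<le> K"
      unfolding split_paired_Ball_Sigma fst_conv by blast
    have "J - 1 / real (Suc m) \<le> val h" using g(2) by (simp add: val sh)
    with vj hD have "v \<in> S m" unfolding S_def mem_Collect_eq dv by (intro conjI)
    then show ?thesis by auto
  qed
  have S_mid: "(\<lambda>j x. (v j x + v' j x) / 2) \<in> S m" if v: "v \<in> S m" and v': "v' \<in> S m" for m v v'
  proof -
    let ?u = "\<lambda>j x. (v j x + v' j x) / 2"
    have du: "diff ?u = (\<lambda>\<alpha> x. (diff v \<alpha> x + diff v' \<alpha> x) / 2)"
      by (auto simp: diff_def fun_eq_iff field_simps)
    have duD: "diff ?u \<in> D" unfolding du using SD(1)[OF v] SD(1)[OF v'] unfolding D_def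
      by (rule dual_feasible_midpoint)
    have "s (diff ?u) x = (s (diff v) x + s (diff v') x) / 2" for x
      unfolding du s_def by (simp add: sum.distrib flip: sum_divide_distrib)
    then have eq: "s (diff ?u) x * w x = (s (diff v) x * w x + s (diff v') x * w x) / 2" for x
      by (simp only:) (simp add: distrib_right)
    have ev: "val (diff ?u) = (val (diff v) + val (diff v')) / 2"
      unfolding val eq using iw[OF int_s[OF SD(1)[OF v]]] iw[OF int_s[OF SD(1)[OF v']]] by simp
    have "e \<le> (p + q) / 2" if "e \<le> p" "e \<le> q" for e p q :: real using that by simp
    then have Ju: "J - 1 / real (Suc m) \<le> val (diff ?u)"
      unfolding ev using SD(2)[OF v] SD(2)[OF v'] by blast
    have uj: "integrable P (?u j) \<and> cylindrical (space P) (fst j) (?u j) \<and>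
      (\<forall>x. 0 \<le> ?u j x) \<and> integral\<^sup>L P (?u j) \<le> K" if j: "j \<in> A \<times> UNIV" for j
    proof (intro conjI allI)
      show "integrable P (?u j)" using Sv(1)[OF v j] Sv(1)[OF v' j] by simp
      show "cylindrical (space P) (fst j) (?u j)"
        by (rule cylindricalI) (metis cylindricalD[OF Sv(2)[OF v j]] cylindricalD[OF Sv(2)[OF v' j]])
      show "0 \<le> ?u j x" for x using Sv(3)[OF v j, of x] Sv(3)[OF v' j, of x] by simp
      show "integral\<^sup>L P (?u j) \<le> K"
        using Sv(1,4)[OF v j] Sv(1,4)[OF v' j] by simp
    qed
    show ?thesis unfolding S_def
      by (rule CollectI, rule conjI, rule ballI, erule uj, rule conjI, rule duD, rule Ju)
  qed
  obtain v where vS: "\<And>m. v m \<in> S m"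
    and conv: "\<And>j. j \<in> A \<times> UNIV \<Longrightarrow> AE x in P. convergent (\<lambda>m. v m j x)"
    by (rule P.convex_ae_convergent_selection[of "A \<times> UNIV" S K])
       (use fin dec S_ne S_mid Sv in \<open>auto simp del: split_paired_All\<close>)
  note vD = SD(1)[OF vS] and vi = Sv[OF vS]
  \<comment> \<open>The Cauchy condition makes the convergence set measurable, and it depends on the
    coordinates in \<alpha> alone. Its complement is thus a null cylinder, and the default 0 on it
    leaves the limit cylindrical at every point.\<close>
  define good where "good \<alpha> x \<longleftrightarrow> Cauchy (\<lambda>m. v m (\<alpha>, True) x) \<and> Cauchy (\<lambda>m. v m (\<alpha>, False) x)" for \<alpha> x
  define l where "l \<alpha> p x = (if good \<alpha> x then Lim sequentially (\<lambda>m. v m (\<alpha>, p) x) else 0)" for \<alpha> p x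
  define f where "f \<alpha> x = l \<alpha> True x - l \<alpha> False x" for \<alpha> x
  have l_lim: "(\<lambda>m. v m (\<alpha>, p) x) \<longlonglongrightarrow> l \<alpha> p x" if "good \<alpha> x" for \<alpha> p x
    using that unfolding good_def l_def
    by (cases p) (auto simp: Cauchy_convergent_iff convergent_LIMSEQ_iff)
  have AE_good: "AE x in P. good \<alpha> x" if "\<alpha> \<in> A" for \<alpha>
    using conv[of "(\<alpha>, True)"] conv[of "(\<alpha>, False)"] that
    by (auto simp: good_def Cauchy_convergent_iff elim: eventually_elim2)
  have v_meas[measurable]: "v m (\<alpha>, p) \<in> borel_measurable P" if "\<alpha> \<in> A" for \<alpha> p m
    using vi(1)[of "(\<alpha>, p)" m] that by auto
  have good_meas: "Measurable.pred P (good \<alpha>)" if "\<alpha> \<in> A" for \<alpha>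
    unfolding good_def[abs_def] pred_def using that
    by (intro sets.sets_Collect_conj sets_Collect_Cauchy v_meas)
  have l_meas: "l \<alpha> p \<in> borel_measurable P" if "\<alpha> \<in> A" for \<alpha> p
    unfolding l_def[abs_def]
    by (intro measurable_If borel_measurable_lim_metric v_meas[OF that])
       (use good_meas[OF that] in \<open>auto simp: pred_def\<close>)
  have v_cyl: "v m (\<alpha>, p) x = v m (\<alpha>, p) y"
    if "\<alpha> \<in> A" "x \<in> space P" "y \<in> space P" "restrict x \<alpha> = restrict y \<alpha>" for m \<alpha> p x y
    using cylindricalD[OF vi(2)[of "(\<alpha>, p)" m], of x y] that by simp
  have good_cyl: "good \<alpha> x = good \<alpha> y"
    if "\<alpha> \<in> A" "x \<in> space P" "y \<in> space P" "restrict x \<alpha> = restrict y \<alpha>" for \<alpha> x y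
    using v_cyl[OF that] unfolding good_def by presburger
  have l_cyl: "l \<alpha> p x = l \<alpha> p y"
    if "\<alpha> \<in> A" "x \<in> space P" "y \<in> space P" "restrict x \<alpha> = restrict y \<alpha>" for \<alpha> p x y
    using v_cyl[OF that] good_cyl[OF that] unfolding l_def by presburger
  have l_int: "integrable P (l \<alpha> p)" if \<alpha>: "\<alpha> \<in> A" for \<alpha> p
  proof (rule limit_of_nonneg_integrable(1))
    show "AE x in P. (\<lambda>m. v m (\<alpha>, p) x) \<longlonglongrightarrow> l \<alpha> p x"
      using AE_good[OF \<alpha>] by eventually_elim (rule l_lim)
    show "AE x in P. 0 \<le> v m (\<alpha>, p) x" for m using vi(3)[of "(\<alpha>, p)" m] \<alpha> by simp
    show "integrable P (v m (\<alpha>, p))" "integral\<^sup>L P (v m (\<alpha>, p)) \<le> K" for m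
      using vi(1,4)[of "(\<alpha>, p)" m] \<alpha> by auto
  qed (use l_meas[OF \<alpha>] in auto)
  have lim_s: "(\<lambda>m. s (diff (v m)) x) \<longlonglongrightarrow> s f x" if "\<And>\<alpha>. \<alpha> \<in> A \<Longrightarrow> good \<alpha> x" for x
    unfolding s_def diff_def f_def by (intro tendsto_sum tendsto_diff l_lim that)
  have "\<exists>N. (\<forall>\<alpha>\<in>A. N \<alpha> \<in> null_sets P \<and> cylindrical (space P) \<alpha> (\<lambda>x. x \<in> N \<alpha>)) \<and>
        (\<forall>x\<in>space P. (\<forall>\<alpha>\<in>A. x \<notin> N \<alpha>) \<longrightarrow> ereal (s (diff (v m)) x) \<le> c x)" for m
    using vD[of m] unfolding D_def dual_feasible_def s_def by simp
  then obtain N where N: "\<And>m \<alpha>. \<alpha> \<in> A \<Longrightarrow> N m \<alpha> \<in> null_sets P"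
      "\<And>m \<alpha>. \<alpha> \<in> A \<Longrightarrow> cylindrical (space P) \<alpha> (\<lambda>x. x \<in> N m \<alpha>)"
      "\<And>m x. x \<in> space P \<Longrightarrow> (\<And>\<alpha>. \<alpha> \<in> A \<Longrightarrow> x \<notin> N m \<alpha>) \<Longrightarrow> ereal (s (diff (v m)) x) \<le> c x"
    by metis
  have fD: "f \<in> D" unfolding D_def
  proof (rule dual_feasibleI)
    fix \<alpha> assume \<alpha>: "\<alpha> \<in> A"
    show "integrable P (f \<alpha>)" unfolding f_def[abs_def] using l_int[OF \<alpha>] by simp
    show "cylindrical (space P) \<alpha> (f \<alpha>)"
      unfolding f_def by (intro cylindricalI arg_cong2[of _ _ _ _ "(-)"] l_cyl \<alpha>)
    have "{x \<in> space P. \<not> good \<alpha> x} \<in> null_sets P"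
      using AE_good[OF \<alpha>] good_meas[OF \<alpha>] by (subst AE_iff_null[symmetric]) auto
    \<comment> \<open>For each \<alpha>, one null cylinder collects the points of divergence and the
      exceptional sets of all members of the sequence.\<close>
    then show "{x \<in> space P. \<not> good \<alpha> x} \<union> (\<Union>m. N m \<alpha>) \<in> null_sets P"
      using N(1)[OF \<alpha>] by (intro null_sets.Un null_sets_UN)
    show "cylindrical (space P) \<alpha> (\<lambda>x. x \<in> {x \<in> space P. \<not> good \<alpha> x} \<union> (\<Union>m. N m \<alpha>))"
    proof (rule cylindricalI)
      fix x y assume xy: "x \<in> space P" "y \<in> space P" "restrict x \<alpha> = restrict y \<alpha>"
      show "(x \<in> {x \<in> space P. \<not> good \<alpha> x} \<union> (\<Union>m. N m \<alpha>)) = (y \<in> {x \<in> space P. \<not> good \<alpha> x} \<union> (\<Union>m. N m \<alpha>))"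
        using good_cyl[OF \<alpha> xy] cylindricalD[OF N(2)[OF \<alpha>] xy] xy by blast
    qed
  next
    fix x assume x: "x \<in> space P" and nx: "\<And>\<alpha>. \<alpha> \<in> A \<Longrightarrow> x \<notin> {x \<in> space P. \<not> good \<alpha> x} \<union> (\<Union>m. N m \<alpha>)"
    have lim: "(\<lambda>m. ereal (s (diff (v m)) x)) \<longlonglongrightarrow> ereal (s f x)"
      by (intro tendsto_ereal lim_s) (use nx x in simp)
    have "ereal (s (diff (v m)) x) \<le> c x" for m
      by (rule N(3)[OF x]) (use nx in simp)
    then show "ereal (\<Sum>\<alpha>\<in>A. f \<alpha> x) \<le> c x"
      unfolding s_def[symmetric] by (intro LIMSEQ_le_const2[OF lim] exI[of _ 0] allI impI)
  qed
  have "(\<integral>x. (G x - s f x) * w x \<partial>P) \<le> Gw - J"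
  proof (rule limit_of_nonneg_integrable(2))
    show "integrable P (\<lambda>x. (G x - s (diff (v m)) x) * w x)"
      "AE x in P. 0 \<le> (G x - s (diff (v m)) x) * w x" for m
      using gap(1,2)[OF vD] .
    show "(\<integral>x. (G x - s (diff (v m)) x) * w x \<partial>P) \<le> Gw - J + 1 / real (Suc m)" for m
      unfolding gap(3)[OF vD] using SD(2)[OF vS, of m] by linarith
    show "(\<lambda>m. Gw - J + 1 / real (Suc m)) \<longlonglongrightarrow> Gw - J"
      using LIMSEQ_Suc[OF lim_1_over_n] tendsto_add[OF tendsto_const[of "Gw - J"]] by fastforce
    have "AE x in P. \<forall>\<alpha>\<in>A. good \<alpha> x" by (rule AE_finite_allI[OF fin AE_good])
    then show "AE x in P. (\<lambda>m. (G x - s (diff (v m)) x) * w x) \<longlonglongrightarrow> (G x - s f x) * w x"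
      by eventually_elim (intro tendsto_intros lim_s, blast)
    show "(\<lambda>x. (G x - s f x) * w x) \<in> borel_measurable P" using gap(1)[OF fD] by auto
  qed
  then have "J \<le> val f" using gap(3)[OF fD] by linarith
  then have "\<forall>h\<in>D. val h \<le> val f" using le_J by force
  with fD show ?thesis unfolding D_def val_def by blast
qed

end

section \<open>Reducible families\<close>

text \<open>The reducing measure appears only through its density \<open>w\<close>, so that every
  integral and null set can be referred to the product measure \<open>P\<close>.\<close>

locale reducible_family = nat_product_prob_space \<nu> "{1..n}"
  for \<nu> :: "nat \<Rightarrow> 'a measure" and n :: nat +
  fixes X :: "nat \<Rightarrow> 'a topology" and k :: nat and \<mu>a :: "nat set \<Rightarrow> (nat \<Rightarrow> 'a) measure"
    and w :: "(nat \<Rightarrow> 'a) \<Rightarrow> real" and a b :: real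
  assumes sets_\<nu>: "\<And>i. i \<in> {1..n} \<Longrightarrow> sets (\<nu> i) = sets (borel_of (X i))"
    and w_meas[measurable]: "w \<in> borel_measurable P"
    and a_pos: "0 < a" and w_ge: "\<And>x. x \<in> space P \<Longrightarrow> a \<le> w x" and w_le: "\<And>x. x \<in> space P \<Longrightarrow> w x \<le> b"
    and prob_density: "prob_space (density P (\<lambda>x. ennreal (w x)))"
    and marginal: "\<And>\<alpha>. \<alpha> \<in> Ink n k \<Longrightarrow> \<mu>a \<alpha> = distr (density P (\<lambda>x. ennreal (w x))) (Xa X \<alpha>) (Pr \<alpha>)"
begin

declare One_nat_def [simp del] \<comment> \<open>otherwise \<open>simp\<close> turns \<open>{1..n}\<close> into \<open>{Suc 0..n}\<close>\<close>

lemma finite_Ink: "finite (Ink n k)"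
  by (rule finite_subset[of _ "Pow {1..n}"]) (auto simp: Ink_def)

lemma Ink_subset: "\<alpha> \<in> Ink n k \<Longrightarrow> \<alpha> \<subseteq> {1..n}"
  by (auto simp: Ink_def)

lemma sets_Xa: "\<alpha> \<subseteq> {1..n} \<Longrightarrow> sets (Xa X \<alpha>) = sets (PiM \<alpha> \<nu>)"
  unfolding Xa_def by (intro sets_PiM_cong) (auto simp: sets_\<nu>)

lemma space_Xa: "\<alpha> \<subseteq> {1..n} \<Longrightarrow> space (Xa X \<alpha>) = space (PiM \<alpha> \<nu>)"
  by (rule sets_eq_imp_space_eq[OF sets_Xa])

lemma w_pos: "x \<in> space P \<Longrightarrow> 0 < w x"
  using w_ge a_pos by force

lemma Pr_measurable: "\<alpha> \<in> Ink n k \<Longrightarrow> Pr \<alpha> \<in> P \<rightarrow>\<^sub>M Xa X \<alpha>"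
  unfolding Pr_def[abs_def] measurable_cong_sets[OF refl sets_Xa[OF Ink_subset]]
  by (rule measurable_restrict_subset[OF Ink_subset])

text \<open>Each bound on \<open>w\<close> serves one direction: \<open>a\<close> for removing the
  weight, \<open>b\<close> for inserting it.\<close>

lemma integrable_weighted_iff:
  assumes "f \<in> borel_measurable P"
  shows "integrable P (\<lambda>x. w x * f x) \<longleftrightarrow> integrable P f"
proof
  assume i: "integrable P (\<lambda>x. w x * f x)"
  show "integrable P f"
  proof (rule Bochner_Integration.integrable_bound[OF _ assms])
    show "integrable P (\<lambda>x. (w x * f x) / a)" using i by simp
    show "AE x in P. norm (f x) \<le> norm ((w x * f x) / a)"
    proof (rule AE_I2)
      fix x assume "x \<in> space P"
      from mult_right_mono[OF w_ge[OF this], of "\<bar>f x\<bar>"] w_pos[OF this]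
      show "norm (f x) \<le> norm ((w x * f x) / a)"
        using a_pos by (simp add: abs_mult field_simps)
    qed
  qed
next
  assume "integrable P f"
  then have "integrable P (\<lambda>x. f x * w x)"
    by (rule integrable_weighted[OF w_meas, of b, rotated]) (use w_pos w_le in force)
  then show "integrable P (\<lambda>x. w x * f x)" by (simp add: mult.commute)
qed

lemma
  assumes \<alpha>: "\<alpha> \<in> Ink n k" and f: "f \<in> borel_measurable (Xa X \<alpha>)"
  shows integrable_marginal: "integrable (\<mu>a \<alpha>) f \<longleftrightarrow> integrable P (\<lambda>x. f (Pr \<alpha> x) :: real)"
    and integral_marginal: "integral\<^sup>L (\<mu>a \<alpha>) f = (\<integral>x. f (Pr \<alpha> x) * w x \<partial>P)"
proof -
  have pm: "Pr \<alpha> \<in> density P (\<lambda>x. ennreal (w x)) \<rightarrow>\<^sub>M Xa X \<alpha>" using Pr_measurable[OF \<alpha>] by simp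
  have fp: "(\<lambda>x. f (Pr \<alpha> x)) \<in> borel_measurable P"
    using measurable_compose[OF Pr_measurable[OF \<alpha>] f] .
  have w0: "AE x in P. 0 \<le> w x" by (intro AE_I2 less_imp_le w_pos)
  have "integrable (\<mu>a \<alpha>) f \<longleftrightarrow> integrable (density P (\<lambda>x. ennreal (w x))) (\<lambda>x. f (Pr \<alpha> x))"
    unfolding marginal[OF \<alpha>] by (rule integrable_distr_eq[OF pm f])
  also have "\<dots> \<longleftrightarrow> integrable P (\<lambda>x. w x * f (Pr \<alpha> x))"
    using integrable_density[OF fp w_meas w0] by simp
  finally show "integrable (\<mu>a \<alpha>) f \<longleftrightarrow> integrable P (\<lambda>x. f (Pr \<alpha> x))"
    unfolding integrable_weighted_iff[OF fp] .
  show "integral\<^sup>L (\<mu>a \<alpha>) f = (\<integral>x. f (Pr \<alpha> x) * w x \<partial>P)"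
    unfolding marginal[OF \<alpha>] integral_distr[OF pm f] integral_density[OF fp w_meas w0]
    by (simp add: mult.commute)
qed

text \<open>A strictly positive density has the same null sets as \<open>P\<close>. Finiteness from
  \<open>prob_density\<close> matters because the real-valued \<open>measure\<close> is also 0 on
  sets of infinite mass.\<close>

lemma null_marginal:
  assumes \<alpha>: "\<alpha> \<in> Ink n k" and Y: "Y \<in> sets (Xa X \<alpha>)"
  shows "measure (\<mu>a \<alpha>) Y = 0 \<longleftrightarrow> Pr \<alpha> -` Y \<inter> space P \<in> null_sets P"
proof -
  interpret D: prob_space "density P (\<lambda>x. ennreal (w x))" by (rule prob_density)
  have pm: "Pr \<alpha> \<in> density P (\<lambda>x. ennreal (w x)) \<rightarrow>\<^sub>M Xa X \<alpha>" using Pr_measurable[OF \<alpha>] by simp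
  have s: "Pr \<alpha> -` Y \<inter> space P \<in> sets P" using measurable_sets[OF Pr_measurable[OF \<alpha>] Y] .
  have "measure (\<mu>a \<alpha>) Y = D.prob (Pr \<alpha> -` Y \<inter> space P)"
    unfolding marginal[OF \<alpha>] measure_distr[OF pm Y] space_density ..
  then have "measure (\<mu>a \<alpha>) Y = 0 \<longleftrightarrow> Pr \<alpha> -` Y \<inter> space P \<in> null_sets (density P (\<lambda>x. ennreal (w x)))"
    using s by (simp add: D.emeasure_eq_measure null_sets_def)
  also have "\<dots> \<longleftrightarrow> (AE x in P. x \<in> Pr \<alpha> -` Y \<inter> space P \<longrightarrow> ennreal (w x) = 0)"
    using s by (simp add: null_sets_density_iff)
  also have "\<dots> \<longleftrightarrow> (AE x in P. x \<notin> Pr \<alpha> -` Y \<inter> space P)"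
    by (rule AE_cong) (auto simp: ennreal_eq_0_iff not_le dest: w_pos)
  also have "\<dots> \<longleftrightarrow> Pr \<alpha> -` Y \<inter> space P \<in> null_sets P"
    using s by (simp add: AE_iff_null_sets)
  finally show ?thesis .
qed

section \<open>Passage between the partial products and the full product\<close>

lemma cylindrical_Pr: "cylindrical (space P) \<alpha> (\<lambda>x. f (Pr \<alpha> x))"
  by (rule cylindricalI) (simp add: Pr_def)

lemma Psi_measurable:
  assumes "f \<in> Psi X n k \<mu>a c" "\<alpha> \<in> Ink n k"
  shows "f \<alpha> \<in> borel_measurable (Xa X \<alpha>)"
proof -
  have "integrable (\<mu>a \<alpha>) (f \<alpha>)" using assms by (auto simp: Psi_def)
  then have "f \<alpha> \<in> borel_measurable (\<mu>a \<alpha>)" by (rule borel_measurable_integrable)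
  then show ?thesis by (simp add: marginal[OF assms(2)])
qed

lemma Psi_imp_dual_feasible:
  assumes f: "f \<in> Psi X n k \<mu>a c"
  shows "(\<lambda>\<alpha> x. f \<alpha> (Pr \<alpha> x)) \<in> dual_feasible (Ink n k) c"
proof -
  from f obtain A where A: "zero_thickness X n k \<mu>a A"
    "\<forall>x\<in>space (Xa X {1..n}) - A. ereal (\<Sum>\<alpha>\<in>Ink n k. f \<alpha> (Pr \<alpha> x)) \<le> c x"
    by (auto simp: Psi_def)
  from A(1) obtain Y where Y: "\<forall>\<alpha>\<in>Ink n k. Y \<alpha> \<in> sets (Xa X \<alpha>) \<and> measure (\<mu>a \<alpha>) (Y \<alpha>) = 0"
    "A \<subseteq> (\<Union>\<alpha>\<in>Ink n k. Pr \<alpha> -` Y \<alpha> \<inter> space (Xa X {1..n}))"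
    by (auto simp: zero_thickness_def)
  show ?thesis
  proof (rule dual_feasibleI)
    fix \<alpha> assume \<alpha>: "\<alpha> \<in> Ink n k"
    show "integrable P (\<lambda>x. f \<alpha> (Pr \<alpha> x))"
      using integrable_marginal[OF \<alpha> Psi_measurable[OF f \<alpha>]] f \<alpha> by (auto simp: Psi_def)
    show "Pr \<alpha> -` Y \<alpha> \<inter> space P \<in> null_sets P"
      using null_marginal[OF \<alpha>] Y(1) \<alpha> by blast
    show "cylindrical (space P) \<alpha> (\<lambda>x. x \<in> Pr \<alpha> -` Y \<alpha> \<inter> space P)"
      by (rule cylindricalI) (auto simp: Pr_def)
  next
    fix x assume x: "x \<in> space P" "\<And>\<alpha>. \<alpha> \<in> Ink n k \<Longrightarrow> x \<notin> Pr \<alpha> -` Y \<alpha> \<inter> space P"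
    then have "x \<notin> A" using Y(2) by (auto simp: space_Xa)
    then show "ereal (\<Sum>\<alpha>\<in>Ink n k. f \<alpha> (Pr \<alpha> x)) \<le> c x" using A(2) x(1) by (simp add: space_Xa)
  qed (rule cylindrical_Pr)
qed

text \<open>Freezing the missing coordinates at one point \<open>x0\<close> gives a measurable right
  inverse \<open>e \<alpha>\<close> of the projection. Composition with it descends both functions
  and null sets, exactly rather than up to null sets, since \<open>cylindrical\<close> holds
  everywhere.\<close>

lemma dual_feasible_imp_Psi:
  assumes h: "h \<in> dual_feasible (Ink n k) c"
  obtains f where "f \<in> Psi X n k \<mu>a c" "\<And>\<alpha> x. \<alpha> \<in> Ink n k \<Longrightarrow> x \<in> space P \<Longrightarrow> f \<alpha> (Pr \<alpha> x) = h \<alpha> x"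
proof -
  obtain N where N: "\<And>\<alpha>. \<alpha> \<in> Ink n k \<Longrightarrow> N \<alpha> \<in> null_sets P"
    "\<And>\<alpha>. \<alpha> \<in> Ink n k \<Longrightarrow> cylindrical (space P) \<alpha> (\<lambda>x. x \<in> N \<alpha>)"
    "\<And>x. x \<in> space P \<Longrightarrow> (\<And>\<alpha>. \<alpha> \<in> Ink n k \<Longrightarrow> x \<notin> N \<alpha>) \<Longrightarrow> ereal (\<Sum>\<alpha>\<in>Ink n k. h \<alpha> x) \<le> c x"
    using h by (elim dual_feasibleE) metis
  note hi = dual_feasible_integrable[OF h]
  obtain x0 where x0: "x0 \<in> space P" using P.not_empty by blast
  define e where "e \<alpha> z = merge \<alpha> ({1..n} - \<alpha>) (z, restrict x0 ({1..n} - \<alpha>))" for \<alpha> and z :: "nat \<Rightarrow> 'a"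
  have x0': "restrict x0 ({1..n} - \<alpha>) \<in> space (PiM ({1..n} - \<alpha>) \<nu>)" for \<alpha>
    using x0 by (auto simp: space_PiM PiE_iff)
  have e_meas: "e \<alpha> \<in> Xa X \<alpha> \<rightarrow>\<^sub>M P" if \<alpha>: "\<alpha> \<in> Ink n k" for \<alpha>
  proof -
    have eq: "\<alpha> \<union> ({1..n} - \<alpha>) = {1..n}" using Ink_subset[OF \<alpha>] by auto
    have "(\<lambda>z. (z, restrict x0 ({1..n} - \<alpha>))) \<in> PiM \<alpha> \<nu> \<rightarrow>\<^sub>M PiM \<alpha> \<nu> \<Otimes>\<^sub>M PiM ({1..n} - \<alpha>) \<nu>"
      using x0' by (intro measurable_Pair measurable_ident_sets[OF refl] measurable_const)
    from measurable_compose[OF this measurable_merge, unfolded eq]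
    show ?thesis
      unfolding measurable_cong_sets[OF sets_Xa[OF Ink_subset[OF \<alpha>]] refl] e_def .
  qed
  have e_Pr: "e \<alpha> (Pr \<alpha> x) \<in> space P" "restrict (e \<alpha> (Pr \<alpha> x)) \<alpha> = restrict x \<alpha>"
    if "\<alpha> \<in> Ink n k" "x \<in> space P" for \<alpha> x
  proof -
    show "e \<alpha> (Pr \<alpha> x) \<in> space P"
      by (intro measurable_space[OF e_meas[OF that(1)]] measurable_space[OF Pr_measurable[OF that(1)] that(2)])
    show "restrict (e \<alpha> (Pr \<alpha> x)) \<alpha> = restrict x \<alpha>"
      by (auto simp: e_def Pr_def merge_def restrict_def)
  qed
  define f where "f \<alpha> z = h \<alpha> (e \<alpha> z)" for \<alpha> z
  have f_Pr: "f \<alpha> (Pr \<alpha> x) = h \<alpha> x" if "\<alpha> \<in> Ink n k" "x \<in> space P" for \<alpha> x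
    unfolding f_def by (rule cylindricalD[OF hi(2)[OF that(1)] e_Pr(1)[OF that] that(2) e_Pr(2)[OF that]])
  have f_meas: "f \<alpha> \<in> borel_measurable (Xa X \<alpha>)" if "\<alpha> \<in> Ink n k" for \<alpha>
    unfolding f_def[abs_def]
    by (rule measurable_compose[OF e_meas[OF that] borel_measurable_integrable[OF hi(1)[OF that]]])
  define Y where "Y \<alpha> = e \<alpha> -` N \<alpha> \<inter> space (Xa X \<alpha>)" for \<alpha>
  have N_sets: "N \<alpha> \<in> sets P" if "\<alpha> \<in> Ink n k" for \<alpha> using N(1)[OF that] by auto
  have Y_sets: "Y \<alpha> \<in> sets (Xa X \<alpha>)" if "\<alpha> \<in> Ink n k" for \<alpha>
    unfolding Y_def by (rule measurable_sets[OF e_meas[OF that] N_sets[OF that]])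
  \<comment> \<open>Equality, not mere inclusion: it transfers nullity from
    \<open>N \<alpha>\<close> to \<open>Y \<alpha>\<close> and makes the union of the
    \<open>N \<alpha>\<close> a set of zero thickness.\<close>
  have Pr_Y: "Pr \<alpha> -` Y \<alpha> \<inter> space P = N \<alpha>" if \<alpha>: "\<alpha> \<in> Ink n k" for \<alpha>
  proof (rule set_eqI)
    fix x
    show "x \<in> Pr \<alpha> -` Y \<alpha> \<inter> space P \<longleftrightarrow> x \<in> N \<alpha>"
    proof (cases "x \<in> space P")
      case True
      have "e \<alpha> (Pr \<alpha> x) \<in> N \<alpha> \<longleftrightarrow> x \<in> N \<alpha>"
        by (rule cylindricalD[OF N(2)[OF \<alpha>] e_Pr(1)[OF \<alpha> True] True e_Pr(2)[OF \<alpha> True]])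
      with True measurable_space[OF Pr_measurable[OF \<alpha>] True] show ?thesis by (simp add: Y_def)
    next
      case False
      then show ?thesis using sets.sets_into_space[OF N_sets[OF \<alpha>]] by auto
    qed
  qed
  have "zero_thickness X n k \<mu>a (\<Union>\<alpha>\<in>Ink n k. N \<alpha>)"
    unfolding zero_thickness_def
  proof (intro conjI exI[of _ Y] ballI)
    show "(\<Union>\<alpha>\<in>Ink n k. N \<alpha>) \<in> sets (Xa X {1..n})"
      unfolding sets_Xa[OF order_refl] by (rule sets.finite_UN[OF finite_Ink N_sets])
    show "(\<Union>\<alpha>\<in>Ink n k. N \<alpha>) \<subseteq> (\<Union>\<alpha>\<in>Ink n k. Pr \<alpha> -` Y \<alpha> \<inter> space (Xa X {1..n}))"
      unfolding space_Xa[OF order_refl] using Pr_Y by blast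
    show "measure (\<mu>a \<alpha>) (Y \<alpha>) = 0" if "\<alpha> \<in> Ink n k" for \<alpha>
      using null_marginal[OF that Y_sets[OF that]] Pr_Y[OF that] N(1)[OF that] by simp
  qed (rule Y_sets)
  moreover have "ereal (\<Sum>\<alpha>\<in>Ink n k. f \<alpha> (Pr \<alpha> x)) \<le> c x"
    if x: "x \<in> space (Xa X {1..n}) - (\<Union>\<alpha>\<in>Ink n k. N \<alpha>)" for x
  proof -
    have xP: "x \<in> space P" using x by (simp add: space_Xa)
    have "(\<Sum>\<alpha>\<in>Ink n k. f \<alpha> (Pr \<alpha> x)) = (\<Sum>\<alpha>\<in>Ink n k. h \<alpha> x)" by (intro sum.cong refl f_Pr xP)
    then show ?thesis using N(3)[OF xP] x by simp
  qed
  moreover have "integrable (\<mu>a \<alpha>) (f \<alpha>)" if \<alpha>: "\<alpha> \<in> Ink n k" for \<alpha>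
  proof -
    have "integrable P (\<lambda>x. f \<alpha> (Pr \<alpha> x)) \<longleftrightarrow> integrable P (h \<alpha>)"
      by (rule Bochner_Integration.integrable_cong[OF refl f_Pr[OF \<alpha>]])
    then show ?thesis using integrable_marginal[OF \<alpha> f_meas[OF \<alpha>]] hi(1)[OF \<alpha>] by simp
  qed
  ultimately have "f \<in> Psi X n k \<mu>a c" unfolding Psi_def by blast
  then show thesis using f_Pr by (rule that)
qed

lemma Psi_value:
  assumes f: "f \<in> Psi X n k \<mu>a c"
  shows "(\<Sum>\<alpha>\<in>Ink n k. integral\<^sup>L (\<mu>a \<alpha>) (f \<alpha>)) = (\<integral>x. (\<Sum>\<alpha>\<in>Ink n k. f \<alpha> (Pr \<alpha> x)) * w x \<partial>P)"
proof -
  have "integrable P (\<lambda>x. f \<alpha> (Pr \<alpha> x) * w x)" if \<alpha>: "\<alpha> \<in> Ink n k" for \<alpha>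
  proof -
    have i: "integrable P (\<lambda>x. f \<alpha> (Pr \<alpha> x))"
      by (rule dual_feasible_integrable(1)[OF Psi_imp_dual_feasible[OF f] \<alpha>])
    show ?thesis
      using i integrable_weighted_iff[OF borel_measurable_integrable[OF i]] by (simp add: mult.commute)
  qed
  then show ?thesis
    using integral_marginal[OF _ Psi_measurable[OF f]] by (simp add: sum_distrib_right)
qed

text \<open>The bound on \<open>c\<close> is used twice: its lower half supplies a feasible tuple,
  its upper half an integrable majorant.\<close>

theorem dual_problem_attained:
  assumes ca_meas: "\<And>\<alpha>. \<alpha> \<in> Ink n k \<Longrightarrow> ca \<alpha> \<in> borel_measurable (\<mu>a \<alpha>)"
    and ca_fin: "\<And>\<alpha> y. \<alpha> \<in> Ink n k \<Longrightarrow> y \<in> space (\<mu>a \<alpha>) \<Longrightarrow> ca \<alpha> y \<noteq> -\<infinity>"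
    and ca_int: "\<And>\<alpha>. \<alpha> \<in> Ink n k \<Longrightarrow> (\<integral>\<^sup>+ y. e2ennreal \<bar>ca \<alpha> y\<bar> \<partial>\<mu>a \<alpha>) < \<infinity>"
    and bound: "\<And>x. x \<in> space (Xa X {1..n}) \<Longrightarrow> \<bar>c x\<bar> \<le> (\<Sum>\<alpha>\<in>Ink n k. ca \<alpha> (Pr \<alpha> x))"
  obtains f where "f \<in> Psi X n k \<mu>a c"
    "\<And>h. h \<in> Psi X n k \<mu>a c \<Longrightarrow>
      (\<Sum>\<alpha>\<in>Ink n k. integral\<^sup>L (\<mu>a \<alpha>) (h \<alpha>)) \<le> (\<Sum>\<alpha>\<in>Ink n k. integral\<^sup>L (\<mu>a \<alpha>) (f \<alpha>))"
proof -
  \<comment> \<open>The real version turns the value \<infinity> into 0, so the bound on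
    \<open>c\<close> can break there; those points lie in \<open>N \<alpha>\<close>, a null cylinder
    by integrability of \<open>ca \<alpha>\<close>.\<close>
  define r where "r \<alpha> y = real_of_ereal (ca \<alpha> y)" for \<alpha> y
  define N where "N \<alpha> = Pr \<alpha> -` {y \<in> space (Xa X \<alpha>). ca \<alpha> y = \<infinity>} \<inter> space P" for \<alpha>
  have ca_meas': "ca \<alpha> \<in> borel_measurable (Xa X \<alpha>)" if \<alpha>: "\<alpha> \<in> Ink n k" for \<alpha>
    using ca_meas[OF \<alpha>] by (simp add: marginal[OF \<alpha>])
  have space_\<mu>a: "space (\<mu>a \<alpha>) = space (Xa X \<alpha>)" if \<alpha>: "\<alpha> \<in> Ink n k" for \<alpha>
    by (simp add: marginal[OF \<alpha>])
  have r_int: "integrable P (\<lambda>x. r \<alpha> (Pr \<alpha> x))" if \<alpha>: "\<alpha> \<in> Ink n k" for \<alpha>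
  proof -
    have "integrable (\<mu>a \<alpha>) (r \<alpha>)"
    proof (rule integrableI_bounded)
      show "r \<alpha> \<in> borel_measurable (\<mu>a \<alpha>)" unfolding r_def[abs_def] using ca_meas[OF \<alpha>] by measurable
      have "ennreal (norm (real_of_ereal z)) \<le> e2ennreal \<bar>z\<bar>" for z
        by (cases z) (auto simp: e2ennreal_infty)
      then have "(\<integral>\<^sup>+ y. ennreal (norm (r \<alpha> y)) \<partial>\<mu>a \<alpha>) \<le> (\<integral>\<^sup>+ y. e2ennreal \<bar>ca \<alpha> y\<bar> \<partial>\<mu>a \<alpha>)"
        unfolding r_def by (intro nn_integral_mono)
      then show "(\<integral>\<^sup>+ y. ennreal (norm (r \<alpha> y)) \<partial>\<mu>a \<alpha>) < \<infinity>" using ca_int[OF \<alpha>] by (rule le_less_trans)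
    qed
    moreover have "r \<alpha> \<in> borel_measurable (Xa X \<alpha>)"
      unfolding r_def[abs_def] using ca_meas'[OF \<alpha>] by measurable
    ultimately show ?thesis using integrable_marginal[OF \<alpha>] by simp
  qed
  have N_null: "N \<alpha> \<in> null_sets P" if \<alpha>: "\<alpha> \<in> Ink n k" for \<alpha>
  proof -
    have S: "{y \<in> space (Xa X \<alpha>). ca \<alpha> y = \<infinity>} \<in> sets (Xa X \<alpha>)"
      using ca_meas'[OF \<alpha>] by measurable
    have "AE y in \<mu>a \<alpha>. e2ennreal \<bar>ca \<alpha> y\<bar> \<noteq> \<infinity>"
      using ca_int[OF \<alpha>] ca_meas[OF \<alpha>] by (intro nn_integral_PInf_AE) auto
    then have "AE y in \<mu>a \<alpha>. y \<notin> {y \<in> space (Xa X \<alpha>). ca \<alpha> y = \<infinity>}"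
      by eventually_elim (auto simp: e2ennreal_infty)
    then have "{y \<in> space (Xa X \<alpha>). ca \<alpha> y = \<infinity>} \<in> null_sets (\<mu>a \<alpha>)"
      using S by (subst AE_iff_null_sets) (simp_all add: marginal[OF \<alpha>])
    then have "measure (\<mu>a \<alpha>) {y \<in> space (Xa X \<alpha>). ca \<alpha> y = \<infinity>} = 0"
      by (simp add: measure_def null_setsD1)
    then show ?thesis unfolding N_def using null_marginal[OF \<alpha> S] by simp
  qed
  have c_le: "\<bar>c x\<bar> \<le> ereal (\<Sum>\<alpha>\<in>Ink n k. r \<alpha> (Pr \<alpha> x))"
    if x: "x \<in> space P" and nx: "\<And>\<alpha>. \<alpha> \<in> Ink n k \<Longrightarrow> x \<notin> N \<alpha>" for x
  proof -
    have "ca \<alpha> (Pr \<alpha> x) = ereal (r \<alpha> (Pr \<alpha> x))" if \<alpha>: "\<alpha> \<in> Ink n k" for \<alpha>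
    proof -
      have s: "Pr \<alpha> x \<in> space (Xa X \<alpha>)" by (rule measurable_space[OF Pr_measurable[OF \<alpha>] x])
      then have "ca \<alpha> (Pr \<alpha> x) \<noteq> \<infinity>" using nx[OF \<alpha>] x by (auto simp: N_def)
      moreover have "ca \<alpha> (Pr \<alpha> x) \<noteq> - \<infinity>" using ca_fin[OF \<alpha>] s by (simp add: space_\<mu>a[OF \<alpha>])
      ultimately show ?thesis by (cases "ca \<alpha> (Pr \<alpha> x)") (simp_all add: r_def)
    qed
    then have "(\<Sum>\<alpha>\<in>Ink n k. ca \<alpha> (Pr \<alpha> x)) = ereal (\<Sum>\<alpha>\<in>Ink n k. r \<alpha> (Pr \<alpha> x))"
      by simp
    with bound[of x] x show ?thesis by (simp add: space_Xa)
  qed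
  have "(\<lambda>\<alpha> x. - r \<alpha> (Pr \<alpha> x)) \<in> dual_feasible (Ink n k) c"
  proof (rule dual_feasibleI)
    fix \<alpha> assume \<alpha>: "\<alpha> \<in> Ink n k"
    show "integrable P (\<lambda>x. - r \<alpha> (Pr \<alpha> x))" using r_int[OF \<alpha>] by simp
    show "N \<alpha> \<in> null_sets P" by (rule N_null[OF \<alpha>])
    show "cylindrical (space P) \<alpha> (\<lambda>x. x \<in> N \<alpha>)"
      by (rule cylindricalI) (simp add: N_def Pr_def)
  next
    fix x assume "x \<in> space P" "\<And>\<alpha>. \<alpha> \<in> Ink n k \<Longrightarrow> x \<notin> N \<alpha>"
    from c_le[OF this] show "ereal (\<Sum>\<alpha>\<in>Ink n k. - r \<alpha> (Pr \<alpha> x)) \<le> c x"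
      by (cases "c x") (auto simp: sum_negf)
  qed (rule cylindrical_Pr)
  then have ne: "dual_feasible (Ink n k) c \<noteq> {}" by auto
  have G: "integrable P (\<lambda>x. \<Sum>\<alpha>\<in>Ink n k. r \<alpha> (Pr \<alpha> x))" using r_int by auto
  have "AE x in P. \<forall>\<alpha>\<in>Ink n k. x \<notin> N \<alpha>"
    by (rule AE_finite_allI[OF finite_Ink]) (rule AE_not_in[OF N_null])
  then have cG: "AE x in P. c x \<le> ereal (\<Sum>\<alpha>\<in>Ink n k. r \<alpha> (Pr \<alpha> x))"
    using AE_space
  proof eventually_elim
    case (elim x)
    then have "\<bar>c x\<bar> \<le> ereal (\<Sum>\<alpha>\<in>Ink n k. r \<alpha> (Pr \<alpha> x))" by (intro c_le) auto
    then show ?case by (cases "c x") auto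
  qed
  obtain g where g: "g \<in> dual_feasible (Ink n k) c" "\<And>h. h \<in> dual_feasible (Ink n k) c \<Longrightarrow>
      (\<integral>x. (\<Sum>\<alpha>\<in>Ink n k. h \<alpha> x) * w x \<partial>P) \<le> (\<integral>x. (\<Sum>\<alpha>\<in>Ink n k. g \<alpha> x) * w x \<partial>P)"
    using dual_attained[OF finite_Ink Ink_subset w_meas a_pos w_ge w_le G cG ne] by auto
  obtain f where f: "f \<in> Psi X n k \<mu>a c" "\<And>\<alpha> x. \<alpha> \<in> Ink n k \<Longrightarrow> x \<in> space P \<Longrightarrow> f \<alpha> (Pr \<alpha> x) = g \<alpha> x"
    using dual_feasible_imp_Psi[OF g(1)] by metis
  have "(\<integral>x. (\<Sum>\<alpha>\<in>Ink n k. f \<alpha> (Pr \<alpha> x)) * w x \<partial>P) = (\<integral>x. (\<Sum>\<alpha>\<in>Ink n k. g \<alpha> x) * w x \<partial>P)"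
    by (intro Bochner_Integration.integral_cong refl arg_cong2[of _ _ _ _ "(*)"] sum.cong f(2))
  then have "(\<Sum>\<alpha>\<in>Ink n k. integral\<^sup>L (\<mu>a \<alpha>) (h \<alpha>)) \<le> (\<Sum>\<alpha>\<in>Ink n k. integral\<^sup>L (\<mu>a \<alpha>) (f \<alpha>))"
    if "h \<in> Psi X n k \<mu>a c" for h
    unfolding Psi_value[OF that] Psi_value[OF f(1)] using g(2)[OF Psi_imp_dual_feasible[OF that]] by simp
  with f(1) show thesis by (rule that)
qed

end

theorem mainTheorem12:
  fixes X :: "nat \<Rightarrow> 'a topology" and n k :: nat
    and \<mu>a :: "nat set \<Rightarrow> (nat \<Rightarrow> 'a) measure"
    and c :: "(nat \<Rightarrow> 'a) \<Rightarrow> ereal"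
    and ca :: "nat set \<Rightarrow> (nat \<Rightarrow> 'a) \<Rightarrow> ereal"
  assumes polish: "\<forall>i\<in>{1..n}. Polish_space (X i)"
    and k: "1 \<le> k" "k < n"
    and mu: "\<forall>\<alpha>\<in>Ink n k. prob_space (\<mu>a \<alpha>) \<and> sets (\<mu>a \<alpha>) = sets (Xa X \<alpha>)"
    and red: "reducible X n k \<mu>a"
    and c_meas: "c \<in> borel_measurable (Xa X {1..n})"
    and ca_meas: "\<forall>\<alpha>\<in>Ink n k. ca \<alpha> \<in> borel_measurable (\<mu>a \<alpha>)"
    and ca_fin: "\<forall>\<alpha>\<in>Ink n k. \<forall>y\<in>space (\<mu>a \<alpha>). ca \<alpha> y \<noteq> -\<infinity>"
    and ca_int: "\<forall>\<alpha>\<in>Ink n k. (\<integral>\<^sup>+ y. e2ennreal \<bar>ca \<alpha> y\<bar> \<partial>\<mu>a \<alpha>) < \<infinity>"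
    and bound: "\<forall>x\<in>space (Xa X {1..n}). \<bar>c x\<bar> \<le> (\<Sum>\<alpha>\<in>Ink n k. ca \<alpha> (Pr \<alpha> x))"
  shows "\<bar>Sup {ereal (\<Sum>\<alpha>\<in>Ink n k. integral\<^sup>L (\<mu>a \<alpha>) (f \<alpha>)) | f. f \<in> Psi X n k \<mu>a c}\<bar> \<noteq> \<infinity>
    \<and> (\<exists>f\<in>Psi X n k \<mu>a c. ereal (\<Sum>\<alpha>\<in>Ink n k. integral\<^sup>L (\<mu>a \<alpha>) (f \<alpha>))
         = Sup {ereal (\<Sum>\<alpha>\<in>Ink n k. integral\<^sup>L (\<mu>a \<alpha>) (f \<alpha>)) | f. f \<in> Psi X n k \<mu>a c})"
proof -
  from red obtain \<mu> \<nu> where \<mu>: "prob_space \<mu>" "\<forall>\<alpha>\<in>Ink n k. distr \<mu> (Xa X \<alpha>) (Pr \<alpha>) = \<mu>a \<alpha>"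
    and \<nu>: "\<forall>i\<in>{1..n}. prob_space (\<nu> i) \<and> sets (\<nu> i) = sets (borel_of (X i))"
    and "unif_equiv \<mu> (PiM {1..n} \<nu>)"
    unfolding reducible_def by auto
  then obtain w a b where w: "w \<in> borel_measurable (PiM {1..n} \<nu>)" "0 < a"
    "\<forall>x\<in>space (PiM {1..n} \<nu>). a \<le> w x \<and> w x \<le> b" "\<mu> = density (PiM {1..n} \<nu>) (\<lambda>x. ennreal (w x))"
    unfolding unif_equiv_def by auto
  \<comment> \<open>The locale for products of probability spaces wants a probability measure at every index.\<close>
  define \<nu>' where "\<nu>' i = (if i \<in> {1..n} then \<nu> i else \<nu> 1)" for i
  have P: "PiM {1..n} \<nu>' = PiM {1..n} \<nu>" by (rule PiM_cong) (auto simp: \<nu>'_def)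
  have prob: "prob_space (\<nu>' i)" for i using \<nu> k by (auto simp: \<nu>'_def)
  have sf: "product_sigma_finite \<nu>'"
    by (rule product_sigma_finite.intro) (rule prob_space_imp_sigma_finite[OF prob])
  interpret reducible_family \<nu>' n X k \<mu>a w a b
  proof (intro reducible_family.intro nat_product_prob_space.intro finite_product_prob_space.intro
      finite_product_sigma_finite.intro product_prob_space.intro)
    show "product_prob_space_axioms \<nu>'" by (rule product_prob_space_axioms.intro) (rule prob)
    show "finite_product_sigma_finite_axioms {1..n}" by (rule finite_product_sigma_finite_axioms.intro) simp
    show "reducible_family_axioms \<nu>' n X k \<mu>a w a b"
      by (rule reducible_family_axioms.intro) (use \<mu> \<nu> w in \<open>auto simp: P \<nu>'_def simp del: One_nat_def\<close>)
  qed (rule sf)+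
  obtain f where f: "f \<in> Psi X n k \<mu>a c" "\<And>h. h \<in> Psi X n k \<mu>a c \<Longrightarrow>
      (\<Sum>\<alpha>\<in>Ink n k. integral\<^sup>L (\<mu>a \<alpha>) (h \<alpha>)) \<le> (\<Sum>\<alpha>\<in>Ink n k. integral\<^sup>L (\<mu>a \<alpha>) (f \<alpha>))"
    by (rule dual_problem_attained[of ca c]) (use ca_meas ca_fin ca_int bound in auto)
  \<comment> \<open>A maximum attained at a real value gives finiteness and attainment at
    once.\<close>
  have "Sup {ereal (\<Sum>\<alpha>\<in>Ink n k. integral\<^sup>L (\<mu>a \<alpha>) (f \<alpha>)) | f. f \<in> Psi X n k \<mu>a c}
      = ereal (\<Sum>\<alpha>\<in>Ink n k. integral\<^sup>L (\<mu>a \<alpha>) (f \<alpha>))"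
    by (rule Sup_eqI) (use f in auto)
  with f(1) show ?thesis by auto
qed

end
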